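(* Let $G$ be a finite nilpotent group, and let $\{a,b\}$ be a generating set of $G$ with at most two elements (so the Cayley digraph $\vec{\mathrm{Cay}}(G;a,b)$ is connected of outvalence $2$). Then the Cayley digraph $\vec{\mathrm{Cay}}(G;a,b)$ has a hamiltonian path.
   Context: For a subset $S$ of a group $G$, the Cayley digraph $\vec{\mathrm{Cay}}(G;S)$ is the directed graph with vertex set $G$ and a directed edge $g \to gs$ for every $g\in G$ and $s\in S$. It is connected exactly when $S$ generates $G$. A hamiltonian path is a directed path visiting every vertex exactly once. *)

theory Defs
  imports "HOL-Algebra.Generated_Groups" "Graph_Theory.Pair_Digraph" "Graph_Theory.Vertex_Walk"
begin

text \<open>The commutator subgroup $[H, K]$, with commutators $h k h^{-1} k^{-1}$ as in
  \<^const>\<open>derived\<close>, which is the case $H = K$.\<close>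

definition commutator_subgroup :: "('a, 'm) monoid_scheme \<Rightarrow> 'a set \<Rightarrow> 'a set \<Rightarrow> 'a set" where
  "commutator_subgroup G H K =
     generate G (\<Union>h\<in>H. \<Union>k\<in>K. {h \<otimes>\<^bsub>G\<^esub> k \<otimes>\<^bsub>G\<^esub> inv\<^bsub>G\<^esub> h \<otimes>\<^bsub>G\<^esub> inv\<^bsub>G\<^esub> k})"

lemma commutator_subgroup_same: "commutator_subgroup G H H = derived G H"
  by (simp add: commutator_subgroup_def derived_def)

primrec lower_central_series :: "('a, 'm) monoid_scheme \<Rightarrow> nat \<Rightarrow> 'a set" where
  "lower_central_series G 0 = carrier G"
| "lower_central_series G (Suc n) =
     commutator_subgroup G (lower_central_series G n) (carrier G)"

text \<open>Like \<open>solvable\<close> in the library, this does not itself assert that \<open>G\<close> is a group.\<close>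

definition nilpotent :: "('a, 'm) monoid_scheme \<Rightarrow> bool" where
  "nilpotent G \<longleftrightarrow> (\<exists>n. lower_central_series G n = {\<one>\<^bsub>G\<^esub>})"

definition cayley_digraph :: "('a, 'm) monoid_scheme \<Rightarrow> 'a set \<Rightarrow> 'a pair_pre_digraph" where
  "cayley_digraph G S =
     \<lparr> pverts = carrier G, parcs = {(g, g \<otimes>\<^bsub>G\<^esub> s) | g s. g \<in> carrier G \<and> s \<in> S} \<rparr>"

lemma (in group) cayley_digraph_wf:
  assumes "S \<subseteq> carrier G"
  shows "pair_wf_digraph (cayley_digraph G S)"
  using assms by unfold_locales (auto simp: cayley_digraph_def)

text \<open>A path is the list of its vertices; \<^const>\<open>vpath\<close> requires it to be nonempty, to follow arcs,
  and to have no repeated vertex.\<close>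

definition hamiltonian_path :: "('a, 'b) pre_digraph \<Rightarrow> 'a list \<Rightarrow> bool" where
  "hamiltonian_path D p \<longleftrightarrow> vpath p D \<and> set p = verts D"

end

theory Submission
  imports Defs "HOL-Algebra.Multiplicative_Group" "HOL-Algebra.Zassenhaus" "HOL-Number_Theory.Cong"
begin

text \<open>Put \<open>c = a b\<inverse>\<close> and \<open>H = \<langle>c\<rangle>\<close>. Suppose the digraph of right cosets of \<open>H\<close> has a hamiltonian
  cycle from \<open>H\<close> to \<open>H\<close>, with word \<open>s w\<close>. Both \<open>a\<close> and \<open>b\<close> lead from \<open>H\<close> to the same coset, so \<open>s\<close>
  may be chosen anew on every round, and a hamiltonian path for the generators \<open>a w = c b w\<close> and \<open>b w\<close>
  of the cyclic group \<open>H\<close> expands to one of \<open>G\<close>.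

  The hamiltonian cycle is found by descending from \<open>G\<close> to \<open>H\<close> through subgroups \<open>K\<close> that
  contain \<open>c\<close> and are generated by \<open>G\<close>-conjugates of \<open>c\<close>; the first step goes to the normal closure
  of \<open>c\<close>. If \<open>K \<noteq> H\<close>, nilpotency gives a normal subgroup \<open>S\<close> of \<open>K\<close> of the same kind
  such that \<open>K/S\<close> is a nontrivial cyclic \<open>p\<close>-group generated by a conjugate \<open>d\<close> of \<open>c\<close>. A cycle for
  \<open>K\<close> with product \<open>x\<close> lifts to one for \<open>S\<close> by repetition as soon as \<open>x\<close> generates \<open>K/S\<close>.
  If it does not, then \<open>x\<close> lies in the subgroup of index \<open>p\<close>; as \<open>d \<in> K\<close>, switching one letter of
  the cycle multiplies \<open>x\<close> by \<open>d\<close> or \<open>d\<inverse>\<close> modulo \<open>S\<close>, and the new product generates.\<close>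

context group
begin

section \<open>Powers and right cosets in finite groups\<close>

lemma inv_mult_cancel_left: "\<lbrakk>x \<in> carrier G; y \<in> carrier G\<rbrakk> \<Longrightarrow> inv x \<otimes> (x \<otimes> y) = y"
  by (simp add: m_assoc[symmetric])

lemma mult_inv_cancel_left: "\<lbrakk>x \<in> carrier G; y \<in> carrier G\<rbrakk> \<Longrightarrow> x \<otimes> (inv x \<otimes> y) = y"
  by (simp add: m_assoc[symmetric])

lemmas word_simps = m_assoc inv_mult_group inv_mult_cancel_left mult_inv_cancel_left

lemma set_multI: "\<lbrakk>x \<in> A; y \<in> B\<rbrakk> \<Longrightarrow> x \<otimes> y \<in> A <#> B"
  by (auto simp: set_mult_def)

lemma conj_pow:
  assumes "g \<in> carrier G" "x \<in> carrier G"
  shows "g \<otimes> x [^] (n::nat) \<otimes> inv g = (g \<otimes> x \<otimes> inv g) [^] n"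
proof (induction n)
  case (Suc n)
  have "g \<otimes> x [^] Suc n \<otimes> inv g = (g \<otimes> x [^] n \<otimes> inv g) \<otimes> (g \<otimes> x \<otimes> inv g)"
    using assms by (simp add: word_simps)
  then show ?case using Suc by simp
qed (use assms in simp)

lemma pow_mem_subgroup:
  assumes "subgroup S G" "x \<in> S"
  shows "x [^] (n::nat) \<in> S"
  by (induction n) (use assms in \<open>auto simp: subgroup.one_closed subgroup.m_closed\<close>)

lemma finite_inv_eq_pow:
  assumes "finite (carrier G)" "x \<in> carrier G"
  shows "inv x = x [^] (order G - 1)"
proof -
  have "order G > 0" using assms order_gt_0_iff_finite by blast
  then have "x [^] (order G - 1) \<otimes> x = \<one>"
    using pow_order_eq_1[OF assms(2)] nat_pow_Suc[of x "order G - 1"] by simp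
  then show ?thesis using assms(2) by (intro inv_equality) auto
qed

text \<open>\<open>k\<close> is the least positive exponent that brings \<open>x\<close> into
  \<open>S\<close>; one exists because \<open>x [^] order G = \<one>\<close>, and division with
  remainder does the rest. It serves as the order of \<open>x\<close> modulo \<open>S\<close>, even
  where the cosets of \<open>S\<close> form no group.\<close>

lemma pow_mem_iff_dvd:
  assumes "finite (carrier G)" "subgroup S G" "x \<in> carrier G"
  obtains k :: nat where "k > 0" "\<And>j::nat. x [^] j \<in> S \<longleftrightarrow> k dvd j"
proof -
  define P where "P j \<longleftrightarrow> j > 0 \<and> x [^] j \<in> S" for j :: nat
  have "order G > 0" using assms order_gt_0_iff_finite by blast
  then have "P (order G)"
    using pow_order_eq_1[OF assms(3)] assms(2) by (simp add: P_def subgroup.one_closed)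
  then have PL: "P (LEAST j. P j)" by (rule LeastI)
  define k where "k = (LEAST j. P j)"
  have k: "k > 0" "x [^] k \<in> S" using PL by (auto simp: k_def P_def)
  have "x [^] j \<in> S \<longleftrightarrow> k dvd j" for j :: nat
  proof -
    have kq: "x [^] (k * (j div k)) \<in> S"
      using pow_mem_subgroup[OF assms(2) k(2), of "j div k"] assms(3) by (simp add: nat_pow_pow)
    have split: "x [^] j = x [^] (k * (j div k)) \<otimes> x [^] (j mod k)"
      using assms(3) by (simp add: nat_pow_mult)
    have "x [^] j \<in> S \<longleftrightarrow> x [^] (j mod k) \<in> S"
    proof
      assume "x [^] j \<in> S"
      then have "inv (x [^] (k * (j div k))) \<otimes> x [^] j \<in> S"
        using kq assms(2) by (simp add: subgroup.m_closed subgroup.m_inv_closed)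
      then show "x [^] (j mod k) \<in> S"
        using assms(3) by (subst (asm) split) (simp add: inv_mult_cancel_left)
    next
      assume "x [^] (j mod k) \<in> S"
      then show "x [^] j \<in> S" using kq assms(2) split by (simp add: subgroup.m_closed)
    qed
    also have "\<dots> \<longleftrightarrow> j mod k = 0"
    proof
      assume "x [^] (j mod k) \<in> S"
      moreover have "\<not> P (j mod k)"
        using not_less_Least[of "j mod k" P] k(1) by (simp add: k_def[symmetric])
      ultimately show "j mod k = 0" by (auto simp: P_def)
    next
      assume "j mod k = 0"
      then show "x [^] (j mod k) \<in> S" using assms(2) by (simp add: subgroup.one_closed)
    qed
    finally show ?thesis by (simp add: dvd_eq_mod_eq_0)
  qed
  then show ?thesis using that k(1) by blast
qed

lemma rcos_eq_iff:
  assumes "subgroup S G" "x \<in> carrier G" "y \<in> carrier G"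
  shows "S #> x = S #> y \<longleftrightarrow> x \<otimes> inv y \<in> S"
  using assms coset_mult_inv1 coset_mult_inv2 coset_join1 coset_join2 subgroup.subset
  by (metis inv_closed m_closed)

lemma rcos_mem_iff:
  assumes "subgroup S G" "x \<in> carrier G" "y \<in> carrier G"
  shows "x \<in> S #> y \<longleftrightarrow> S #> x = S #> y"
  using assms repr_independence repr_independenceD by metis

lemma rcos_mult_right_cong:
  assumes "S \<subseteq> carrier G" "x \<in> carrier G" "y \<in> carrier G" "z \<in> carrier G" "S #> x = S #> y"
  shows "S #> (x \<otimes> z) = S #> (y \<otimes> z)"
  using assms coset_mult_assoc by metis

text \<open>Left multiplication respects right cosets once the multiplier normalises
  \<open>S\<close>. Normality is stated elementwise, so that it can be applied when \<open>S\<close>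
  is normal only in some subgroup of \<open>G\<close>.\<close>

lemma rcos_mult_left_cong:
  assumes "subgroup S G" "x \<in> carrier G" "y \<in> carrier G" "k \<in> carrier G"
    and "\<And>m. m \<in> S \<Longrightarrow> k \<otimes> m \<otimes> inv k \<in> S" and "S #> x = S #> y"
  shows "S #> (k \<otimes> x) = S #> (k \<otimes> y)"
proof -
  have "x \<otimes> inv y \<in> S" using assms rcos_eq_iff by blast
  then have "k \<otimes> (x \<otimes> inv y) \<otimes> inv k \<in> S" using assms by blast
  then have "(k \<otimes> x) \<otimes> inv (k \<otimes> y) \<in> S" using assms by (simp add: word_simps)
  then show ?thesis using assms rcos_eq_iff by simp
qed

lemma rcos_pow_cong:
  assumes "subgroup S G" "x \<in> carrier G" "y \<in> carrier G"
    and "\<And>m. m \<in> S \<Longrightarrow> x \<otimes> m \<otimes> inv x \<in> S" and "S #> x = S #> y"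
  shows "S #> (x [^] (n::nat)) = S #> (y [^] n)"
proof (induction n)
  case (Suc n)
  have "S #> (x \<otimes> x [^] n) = S #> (x \<otimes> y [^] n)"
    using assms Suc by (intro rcos_mult_left_cong) auto
  also have "\<dots> = S #> (y \<otimes> y [^] n)"
    using assms by (intro rcos_mult_right_cong) (auto dest: subgroup.subset)
  finally show ?case using assms by (simp only: nat_pow_Suc2)
qed simp

text \<open>Modulo the normal subgroup \<open>S\<close> only \<open>x\<close> is left of the
  generators, so the quotient is cyclic. Finiteness turns \<open>inv x\<close> into a power with
  natural exponent.\<close>

lemma generate_insert_rcos:
  assumes fin: "finite (carrier G)" and S: "subgroup S G" and x: "x \<in> carrier G"
    and norm: "\<And>k m. k \<in> generate G (insert x S) \<Longrightarrow> m \<in> S \<Longrightarrow> k \<otimes> m \<otimes> inv k \<in> S"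
    and z: "z \<in> generate G (insert x S)"
  shows "\<exists>j::nat. S #> z = S #> (x [^] j)"
  using z
proof (induction z)
  case one
  then show ?case using x by (intro exI[of _ 0]) simp
next
  case (incl h)
  then consider "h = x" | "h \<in> S" by blast
  then show ?case
  proof cases
    case 1
    then show ?thesis using x by (intro exI[of _ 1]) simp
  next
    case 2
    then have "S #> h = S #> x [^] (0::nat)"
      using S x by (simp add: coset_join2 subgroup.mem_carrier subgroup.subset)
    then show ?thesis by blast
  qed
next
  case (inv h)
  then consider "h = x" | "h \<in> S" by blast
  then show ?case
  proof cases
    case 1
    then show ?thesis using finite_inv_eq_pow[OF fin x] by metis
  next
    case 2
    then have "S #> inv h = S #> x [^] (0::nat)"
      using S x by (simp add: coset_join2 subgroup.mem_carrier subgroup.subset subgroup.m_inv_closed)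
    then show ?thesis by blast
  qed
next
  case (eng h1 h2)
  then obtain i j :: nat where ij: "S #> h1 = S #> x [^] i" "S #> h2 = S #> x [^] j" by blast
  have sub: "insert x S \<subseteq> carrier G" using S x subgroup.subset by blast
  have h: "h1 \<in> carrier G" "h2 \<in> carrier G" using eng generate_in_carrier[OF sub] by auto
  have "S #> (h1 \<otimes> h2) = S #> (h1 \<otimes> x [^] j)"
    using S h x norm[OF eng.hyps(1)] ij(2) by (intro rcos_mult_left_cong) auto
  also have "\<dots> = S #> (x [^] i \<otimes> x [^] j)"
    using S h x ij(1) by (intro rcos_mult_right_cong) (auto dest: subgroup.subset)
  finally show ?case using x by (auto simp: nat_pow_mult)
qed

subsection \<open>Nilpotent groups\<close>

text \<open>Conjugation by \<open>g\<close> turns the commutator of \<open>h\<close> and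
  \<open>k\<close> into that of their conjugates, so by induction it preserves the generating
  set.\<close>

lemma lower_central_series_normal: "lower_central_series G n \<lhd> G"
proof (induction n)
  case 0
  show ?case by (simp add: normal_invI subgroup_self)
next
  case (Suc n)
  let ?L = "lower_central_series G n"
  have sub: "?L \<subseteq> carrier G" using Suc normal_imp_subgroup subgroup.subset by blast
  show ?case unfolding lower_central_series.simps commutator_subgroup_def
  proof (rule normal_generateI)
    show "(\<Union>h\<in>?L. \<Union>k\<in>carrier G. {h \<otimes> k \<otimes> inv h \<otimes> inv k}) \<subseteq> carrier G"
      using sub by blast
  next
    fix z g assume z: "z \<in> (\<Union>h\<in>?L. \<Union>k\<in>carrier G. {h \<otimes> k \<otimes> inv h \<otimes> inv k})" and g: "g \<in> carrier G"
    then obtain h k where hk: "h \<in> ?L" "k \<in> carrier G" "z = h \<otimes> k \<otimes> inv h \<otimes> inv k" by blast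
    have hG: "h \<in> carrier G" using hk sub by blast
    have "g \<otimes> z \<otimes> inv g = (g \<otimes> h \<otimes> inv g) \<otimes> (g \<otimes> k \<otimes> inv g) \<otimes> inv (g \<otimes> h \<otimes> inv g) \<otimes> inv (g \<otimes> k \<otimes> inv g)"
      using hk hG g by (simp add: word_simps)
    moreover have "g \<otimes> h \<otimes> inv g \<in> ?L" using Suc hk g by (simp add: normal.inv_op_closed2)
    ultimately show "g \<otimes> z \<otimes> inv g \<in> (\<Union>h\<in>?L. \<Union>k\<in>carrier G. {h \<otimes> k \<otimes> inv h \<otimes> inv k})"
      using g hk(2) by blast
  qed
qed

lemma commutator_mem_lower_central_series:
  assumes "h \<in> lower_central_series G n" "k \<in> carrier G"
  shows "h \<otimes> k \<otimes> inv h \<otimes> inv k \<in> lower_central_series G (Suc n)"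
  unfolding lower_central_series.simps commutator_subgroup_def
  using assms by (intro generate.incl) blast

text \<open>In a nilpotent group a proper subgroup of \<open>K\<close> has a proper normal closure
  in \<open>K\<close>. By induction on \<open>n\<close>, \<open>K\<close> lies in the product of
  \<open>M\<close> with the \<open>n\<close>-th term of the lower central series: for
  \<open>k = u \<otimes> l\<close> the factor \<open>l\<close> is central modulo the next term, so
  conjugating \<open>m\<close> by \<open>k\<close> amounts to conjugating it by
  \<open>u \<in> M\<close>.\<close>

lemma nilpotent_normal_closure_eq:
  assumes nil: "nilpotent G" and M: "subgroup M G" and K: "subgroup K G" and MK: "M \<subseteq> K"
    and cl: "K \<subseteq> generate G {k \<otimes> m \<otimes> inv k | k m. k \<in> K \<and> m \<in> M}"
  shows "M = K"
proof -
  have MG: "M \<subseteq> carrier G" and KG: "K \<subseteq> carrier G" using M K subgroup.subset by blast+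
  have main: "K \<subseteq> M <#> lower_central_series G n" for n
  proof (induction n)
    case 0
    show ?case
    proof
      fix k assume "k \<in> K"
      then have "k = \<one> \<otimes> k" "k \<in> lower_central_series G 0" using KG by auto
      then show "k \<in> M <#> lower_central_series G 0"
        using set_multI[OF subgroup.one_closed[OF M]] by metis
    qed
  next
    case (Suc n)
    let ?L = "lower_central_series G n" and ?L' = "lower_central_series G (Suc n)"
    have L: "subgroup ?L G" and L': "?L' \<lhd> G" "subgroup ?L' G"
      using lower_central_series_normal normal_imp_subgroup by blast+
    have sub: "subgroup (M <#> ?L') G"
      using mult_norm_subgroup[OF L'(1) M] commut_normal[OF M L'(1)] by simp
    have "{k \<otimes> m \<otimes> inv k | k m. k \<in> K \<and> m \<in> M} \<subseteq> M <#> ?L'"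
    proof clarify
      fix k m assume k: "k \<in> K" and m: "m \<in> M"
      then obtain u l where u: "u \<in> M" and l: "l \<in> ?L" and kul: "k = u \<otimes> l"
        using Suc by (auto simp: set_mult_def)
      have G: "u \<in> carrier G" "l \<in> carrier G" "m \<in> carrier G"
        using u l m MG subgroup.subset[OF L] by auto
      have c: "l \<otimes> m \<otimes> inv l \<otimes> inv m \<in> ?L'"
        using commutator_mem_lower_central_series[OF l G(3)] .
      \<comment> \<open>The commutator of \<open>l\<close> and \<open>m\<close> is moved to the
        right of \<open>m\<close>, which conjugates it by \<open>inv m\<close> and keeps it in the
        normal subgroup \<open>?L'\<close>.\<close>
      have "(u \<otimes> m) \<otimes> (inv m \<otimes> (l \<otimes> m \<otimes> inv l \<otimes> inv m) \<otimes> m) \<otimes> inv u \<in> M <#> ?L'"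
      proof -
        have "inv m \<otimes> (l \<otimes> m \<otimes> inv l \<otimes> inv m) \<otimes> m \<in> ?L'"
          using c L'(1) G by (simp add: normal.inv_op_closed1)
        moreover have "u \<otimes> m \<in> M" using u m M by (simp add: subgroup.m_closed)
        ultimately have "(u \<otimes> m) \<otimes> (inv m \<otimes> (l \<otimes> m \<otimes> inv l \<otimes> inv m) \<otimes> m) \<in> M <#> ?L'"
          using set_multI by blast
        moreover have "inv u = inv u \<otimes> \<one>" using G by simp
        then have "inv u \<in> M <#> ?L'"
          using set_multI[OF subgroup.m_inv_closed[OF M u] subgroup.one_closed[OF L'(2)]] by simp
        ultimately show ?thesis using subgroup.m_closed[OF sub] by blast
      qed
      moreover have "(u \<otimes> m) \<otimes> (inv m \<otimes> (l \<otimes> m \<otimes> inv l \<otimes> inv m) \<otimes> m) \<otimes> inv u = k \<otimes> m \<otimes> inv k"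
        using G by (simp add: kul word_simps)
      ultimately show "k \<otimes> m \<otimes> inv k \<in> M <#> ?L'" by simp
    qed
    then show ?case using cl generate_subgroup_incl[OF _ sub] by blast
  qed
  obtain n where "lower_central_series G n = {\<one>}" using nil by (auto simp: nilpotent_def)
  then have "K \<subseteq> M <#> {\<one>}" using main[of n] by simp
  also have "\<dots> \<subseteq> M" using MG by (auto simp: set_mult_def)
  finally show ?thesis using MK by blast
qed

text \<open>Here \<open>z\<close> is the commutator of \<open>x\<close> and \<open>y\<close>. Each
  \<open>x\<close> that passes \<open>y\<close> leaves one \<open>z\<close> behind, and these
  collect on the left because \<open>x\<close> commutes with \<open>z\<close>, hence with its
  powers, modulo \<open>S\<close>.\<close>

lemma rcos_conj_pow:
  assumes S: "S \<lhd> G" and xyz: "x \<in> carrier G" "y \<in> carrier G" "z \<in> carrier G"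
    and z: "x \<otimes> y = z \<otimes> y \<otimes> x" and cx: "S #> (x \<otimes> z) = S #> (z \<otimes> x)"
  shows "S #> (x [^] (n::nat) \<otimes> y) = S #> (z [^] n \<otimes> y \<otimes> x [^] n)"
proof -
  have sub: "subgroup S G" using S normal_imp_subgroup by blast
  have norm: "k \<otimes> m \<otimes> inv k \<in> S" if "k \<in> carrier G" "m \<in> S" for k m
    using S that by (simp add: normal.inv_op_closed2)
  have SG: "S \<subseteq> carrier G" using sub subgroup.subset by blast
  have cp: "S #> (x \<otimes> z [^] n) = S #> (z [^] n \<otimes> x)" for n :: nat
  proof (induction n)
    case (Suc n)
    have "S #> (x \<otimes> z [^] Suc n) = S #> ((x \<otimes> z [^] n) \<otimes> z)" using xyz by (simp add: m_assoc)
    also have "\<dots> = S #> ((z [^] n \<otimes> x) \<otimes> z)" using xyz Suc SG by (intro rcos_mult_right_cong) auto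
    also have "\<dots> = S #> (z [^] n \<otimes> (x \<otimes> z))" using xyz by (simp add: m_assoc)
    also have "\<dots> = S #> (z [^] n \<otimes> (z \<otimes> x))" using xyz cx sub norm by (intro rcos_mult_left_cong) auto
    finally show ?case using xyz by (simp add: m_assoc)
  qed (use xyz in simp)
  show ?thesis
  proof (induction n)
    case (Suc n)
    have "S #> (x [^] Suc n \<otimes> y) = S #> (x \<otimes> (x [^] n \<otimes> y))"
      using xyz by (simp only: nat_pow_Suc2) (simp add: m_assoc)
    also have "\<dots> = S #> (x \<otimes> (z [^] n \<otimes> y \<otimes> x [^] n))"
      using xyz Suc sub norm by (intro rcos_mult_left_cong) auto
    also have "\<dots> = S #> ((x \<otimes> z [^] n) \<otimes> (y \<otimes> x [^] n))" using xyz by (simp add: m_assoc)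
    also have "\<dots> = S #> ((z [^] n \<otimes> x) \<otimes> (y \<otimes> x [^] n))"
      using xyz cp SG by (intro rcos_mult_right_cong) auto
    also have "(z [^] n \<otimes> x) \<otimes> (y \<otimes> x [^] n) = z [^] n \<otimes> (x \<otimes> y) \<otimes> x [^] n"
      using xyz by (simp add: m_assoc)
    also have "\<dots> = z [^] Suc n \<otimes> y \<otimes> (x \<otimes> x [^] n)" unfolding z using xyz by (simp add: m_assoc)
    also have "x \<otimes> x [^] n = x [^] Suc n" using xyz by (simp only: nat_pow_Suc2)
    finally show ?case .
  qed (use xyz in simp)
qed

text \<open>The commutator \<open>z\<close> lies in every term of the lower central series, hence is
  trivial. If it lies in one term, it is central modulo the next; then
  \<open>x [^] u = \<one>\<close> and \<open>y [^] v = \<one>\<close> force its order modulo that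
  term to divide both \<open>u\<close> and \<open>v\<close>, so the order is 1.\<close>

lemma nilpotent_coprime_commute:
  assumes nil: "nilpotent G" and fin: "finite (carrier G)"
    and xy: "x \<in> carrier G" "y \<in> carrier G"
    and u: "x [^] (u::nat) = \<one>" and v: "y [^] (v::nat) = \<one>" and uv: "coprime u v"
  shows "x \<otimes> y = y \<otimes> x"
proof -
  define z where "z = x \<otimes> y \<otimes> inv x \<otimes> inv y"
  have zG: "z \<in> carrier G" using xy by (simp add: z_def)
  have zxy: "x \<otimes> y = z \<otimes> y \<otimes> x" using xy by (simp add: z_def word_simps)
  \<comment> \<open>With \<open>x\<close> and \<open>y\<close> exchanged, \<open>inv z\<close> takes
    the place of \<open>z\<close>, so the same computation serves for \<open>v\<close>.\<close>
  have zyx: "y \<otimes> x = inv z \<otimes> x \<otimes> y" using xy by (simp add: z_def word_simps)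
  have zn: "z \<in> lower_central_series G n" for n
  proof (induction n)
    case 0
    then show ?case using zG by simp
  next
    case (Suc n)
    let ?S = "lower_central_series G (Suc n)"
    have S: "?S \<lhd> G" and sub: "subgroup ?S G" and subn: "subgroup (lower_central_series G n) G"
      using lower_central_series_normal normal_imp_subgroup by blast+
    have comm: "?S #> (h \<otimes> w) = ?S #> (w \<otimes> h)" if "h \<in> lower_central_series G n" "w \<in> carrier G" for h w
    proof -
      have h: "h \<in> carrier G" using that subgroup.mem_carrier[OF subn] by blast
      have "(h \<otimes> w) \<otimes> inv (w \<otimes> h) \<in> ?S"
        using commutator_mem_lower_central_series[OF that] h that(2) by (simp add: word_simps)
      then show ?thesis using rcos_eq_iff[OF sub] h that(2) by simp
    qed
    obtain k where k: "k > 0" "\<And>j::nat. z [^] j \<in> ?S \<longleftrightarrow> k dvd j"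
      using pow_mem_iff_dvd[OF fin sub zG] by blast
    have "?S #> y = ?S #> (z [^] u \<otimes> y)"
      using rcos_conj_pow[OF S xy zG zxy comm[OF Suc xy(1), symmetric], of u] xy zG by (simp add: u)
    then have "y \<otimes> inv (z [^] u \<otimes> y) \<in> ?S"
      using xy zG by (subst rcos_eq_iff[OF sub, symmetric]) auto
    then have "inv (z [^] u) \<in> ?S" using xy zG by (simp add: word_simps)
    then have "inv (inv (z [^] u)) \<in> ?S" using sub subgroup.m_inv_closed by fast
    then have ku: "k dvd u" using k zG by simp
    have iz: "inv z \<in> lower_central_series G n" using Suc subn subgroup.m_inv_closed by fast
    have "?S #> x = ?S #> ((inv z) [^] v \<otimes> x)"
      using rcos_conj_pow[OF S xy(2,1) inv_closed[OF zG] zyx comm[OF iz xy(2), symmetric], of v] xy zG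
      by (simp add: v)
    then have "x \<otimes> inv ((inv z) [^] v \<otimes> x) \<in> ?S"
      using xy zG by (subst rcos_eq_iff[OF sub, symmetric]) auto
    then have "z [^] v \<in> ?S" using xy zG by (simp add: word_simps nat_pow_inv)
    then have "k dvd v" using k by simp
    then have "k = 1" using ku uv coprime_common_divisor_nat by blast
    then have "z [^] (1::nat) \<in> ?S" by (subst k(2)) simp
    then show ?case using zG by simp
  qed
  obtain n where "lower_central_series G n = {\<one>}" using nil by (auto simp: nilpotent_def)
  then have "z = \<one>" using zn[of n] by simp
  then show ?thesis using zxy xy by simp
qed


section \<open>Cyclic extensions of a subgroup\<close>

lemma rcos_pow_mod_cong:
  assumes S: "subgroup S G" and d: "d \<in> carrier G" and q: "d [^] (q::nat) \<in> S" and mn: "[m = n] (mod q)"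
  shows "S #> (d [^] m) = S #> (d [^] n)"
proof -
  have red: "S #> (d [^] m) = S #> (d [^] (m mod q))" for m :: nat
  proof -
    have "(d [^] q) [^] (m div q) \<in> S" using pow_mem_subgroup[OF S q] .
    then have "S #> d [^] (q * (m div q)) = S"
      using d S coset_join2[of "d [^] (q * (m div q))" S] by (simp add: nat_pow_pow)
    moreover have "d [^] m = d [^] (q * (m div q)) \<otimes> d [^] (m mod q)"
      using d by (simp add: nat_pow_mult)
    ultimately show ?thesis using S d coset_mult_assoc subgroup.subset by (metis nat_pow_closed)
  qed
  show ?thesis using red[of m] red[of n] mn by (simp add: cong_def)
qed

text \<open>Every element is \<open>m \<otimes> x [^] j\<close> for exactly one pair of
  \<open>m \<in> S\<close> and \<open>j < q\<close>: two such forms of one element would put a power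
  of \<open>x\<close> with exponent below \<open>q\<close> into \<open>S\<close>.\<close>

lemma card_generate_insert:
  assumes fin: "finite (carrier G)" and S: "subgroup S G" and x: "x \<in> carrier G"
    and norm: "\<And>k m. k \<in> generate G (insert x S) \<Longrightarrow> m \<in> S \<Longrightarrow> k \<otimes> m \<otimes> inv k \<in> S"
    and q: "q > 0" "\<And>j::nat. x [^] j \<in> S \<longleftrightarrow> q dvd j"
  shows "card (generate G (insert x S)) = q * card S"
proof -
  let ?K = "generate G (insert x S)"
  have K: "subgroup ?K G" using S x subgroup.subset by (intro generate_is_subgroup) blast
  have xK: "x \<in> ?K" and SK: "S \<subseteq> ?K" by (auto intro: generate.incl)
  have SG: "S \<subseteq> carrier G" using S subgroup.subset by blast
  have "bij_betw (\<lambda>(m, j). m \<otimes> x [^] j) (S \<times> {..<q}) ?K"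
    unfolding bij_betw_def
  proof
    show "inj_on (\<lambda>(m, j). m \<otimes> x [^] j) (S \<times> {..<q})"
    proof -
      \<comment> \<open>The exponents are taken in order here; the other case follows by exchanging
        the two pairs.\<close>
      have le: "i = j \<and> m = m'" if A: "m \<in> S" "m' \<in> S" "i < q" "j < q" "i \<le> j" "m \<otimes> x [^] i = m' \<otimes> x [^] j"
        for m m' and i j :: nat
      proof -
        have G: "m \<in> carrier G" "m' \<in> carrier G" using A SG by auto
        have "x [^] j = x [^] (j - i) \<otimes> x [^] i" using A x by (simp add: nat_pow_mult)
        then have "m \<otimes> x [^] i = (m' \<otimes> x [^] (j - i)) \<otimes> x [^] i" using A G x by (simp add: m_assoc)
        then have m: "m = m' \<otimes> x [^] (j - i)" using G x by simp
        then have "x [^] (j - i) = inv m' \<otimes> m" using G x by (simp add: inv_mult_cancel_left)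
        then have "q dvd j - i" using A S q(2) subgroup.m_closed subgroup.m_inv_closed by metis
        moreover have "j - i < q" using A by linarith
        ultimately have "\<not> 0 < j - i" using nat_dvd_not_less by blast
        then have "i = j" using A by simp
        then show ?thesis using m G by simp
      qed
      show ?thesis
      proof (rule inj_onI, clarsimp)
        fix m m' and i j :: nat
        assume "m \<in> S" "m' \<in> S" "i < q" "j < q" "m \<otimes> x [^] i = m' \<otimes> x [^] j"
        then show "m = m' \<and> i = j" using le[of m m' i j] le[of m' m j i] by (cases "i \<le> j") auto
      qed
    qed
    show "(\<lambda>(m, j). m \<otimes> x [^] j) ` (S \<times> {..<q}) = ?K"
    proof
      show "(\<lambda>(m, j). m \<otimes> x [^] j) ` (S \<times> {..<q}) \<subseteq> ?K"
        using SK pow_mem_subgroup[OF K xK] subgroup.m_closed[OF K] by auto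
      show "?K \<subseteq> (\<lambda>(m, j). m \<otimes> x [^] j) ` (S \<times> {..<q})"
      proof
        fix z assume z: "z \<in> ?K"
        then have zG: "z \<in> carrier G" using subgroup.mem_carrier[OF K] by blast
        obtain j :: nat where "S #> z = S #> x [^] j"
          using generate_insert_rcos[OF fin S x norm z] by blast
        also have "\<dots> = S #> x [^] (j mod q)"
          using q(2)[of q] by (intro rcos_pow_mod_cong[OF S x]) auto
        finally have "z \<in> S #> x [^] (j mod q)" using rcos_mem_iff[OF S zG] x by simp
        then obtain m where "m \<in> S" "z = m \<otimes> x [^] (j mod q)" by (auto simp: r_coset_def)
        then show "z \<in> (\<lambda>(m, j). m \<otimes> x [^] j) ` (S \<times> {..<q})"
          using q(1) by (intro image_eqI[of _ _ "(m, j mod q)"]) auto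
      qed
    qed
  qed
  then have "card ?K = card (S \<times> {..<q})" by (simp add: bij_betw_same_card)
  then show ?thesis by (simp add: card_cartesian_product mult.commute)
qed

subsection \<open>Tours of right coset digraphs\<close>

definition lprod :: "'a list \<Rightarrow> 'a" where
  "lprod xs = foldr (\<otimes>) xs \<one>"

lemma lprod_simps [simp]: "lprod [] = \<one>" "lprod (x # xs) = x \<otimes> lprod xs"
  by (simp_all add: lprod_def)

lemma lprod_closed [simp]: "set xs \<subseteq> carrier G \<Longrightarrow> lprod xs \<in> carrier G"
  by (induction xs) auto

lemma lprod_append:
  "\<lbrakk>set xs \<subseteq> carrier G; set ys \<subseteq> carrier G\<rbrakk> \<Longrightarrow> lprod (xs @ ys) = lprod xs \<otimes> lprod ys"
  by (induction xs) (auto simp: m_assoc)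

lemma lprod_concat_replicate:
  "set xs \<subseteq> carrier G \<Longrightarrow> lprod (concat (replicate n xs)) = lprod xs [^] n"
proof (induction n)
  case (Suc n)
  have "set (concat (replicate n xs)) \<subseteq> carrier G" using Suc.prems by (cases n) auto
  then show ?case using Suc by (simp add: lprod_append nat_pow_Suc2[symmetric] del: nat_pow_Suc)
qed simp

text \<open>The word \<open>ws\<close> of a closed walk from K to K in the digraph of right cosets of K; the
  length makes the covering walk visit every coset only once.\<close>

definition coset_tour :: "'a set \<Rightarrow> 'a set \<Rightarrow> 'a list \<Rightarrow> bool" where
  "coset_tour A K ws \<longleftrightarrow> set ws \<subseteq> A \<and> length ws * card K = order G \<and> lprod ws \<in> K \<and>
     (\<forall>g\<in>carrier G. \<exists>i<length ws. g \<in> K #> lprod (take i ws))"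

text \<open>\<open>K/S\<close> is cyclic and generated by the product \<open>x\<close> of the tour.
  If \<open>q\<close> is its order, each coset of \<open>K\<close> splits into \<open>q\<close>
  cosets of \<open>S\<close>, which differ by powers of \<open>x\<close> on the left, and round
  \<open>j\<close> of the repeated tour visits those belonging to \<open>x [^] j\<close>.\<close>

lemma coset_tour_lift:
  assumes fin: "finite (carrier G)" and A: "A \<subseteq> carrier G" and S: "subgroup S G" and K: "subgroup K G"
    and norm: "\<And>k m. k \<in> K \<Longrightarrow> m \<in> S \<Longrightarrow> k \<otimes> m \<otimes> inv k \<in> S"
    and tour: "coset_tour A K ws" and gen: "generate G (insert (lprod ws) S) = K"
  shows "\<exists>ws'. coset_tour A S ws'"
proof -
  define x where "x = lprod ws"
  have ws: "set ws \<subseteq> A" "length ws * card K = order G" "x \<in> K"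
    and cover: "\<And>g. g \<in> carrier G \<Longrightarrow> \<exists>i<length ws. g \<in> K #> lprod (take i ws)"
    using tour by (auto simp: coset_tour_def x_def)
  have wsG: "set ws \<subseteq> carrier G" using ws A by blast
  have x: "x \<in> carrier G" using wsG by (simp add: x_def)
  have gen': "generate G (insert x S) = K" using gen by (simp add: x_def)
  have SG: "S \<subseteq> carrier G" using S subgroup.subset by blast
  obtain q where q: "q > 0" "\<And>j::nat. x [^] j \<in> S \<longleftrightarrow> q dvd j"
    using pow_mem_iff_dvd[OF fin S x] by blast
  let ?ws = "concat (replicate q ws)"
  have len: "length ?ws = q * length ws" by (simp add: length_concat sum_list_replicate)
  have cK: "card K = q * card S"
    using card_generate_insert[OF fin S x _ q] norm gen' by simp
  have "coset_tour A S ?ws"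
    unfolding coset_tour_def
  proof (intro conjI ballI)
    show "set ?ws \<subseteq> A" using ws by auto
    show "length ?ws * card S = order G" using ws cK len by (simp add: mult.commute mult.left_commute)
    show "lprod ?ws \<in> S" using wsG q by (simp add: lprod_concat_replicate x_def)
    fix g assume g: "g \<in> carrier G"
    then obtain i where i: "i < length ws" "g \<in> K #> lprod (take i ws)" using cover by blast
    then obtain k where k: "k \<in> K" "g = k \<otimes> lprod (take i ws)" by (auto simp: r_coset_def)
    have kG: "k \<in> carrier G" using k K subgroup.mem_carrier by fast
    have tG: "set (take i ws) \<subseteq> carrier G" using wsG set_take_subset by fast
    have "\<exists>j::nat. S #> k = S #> (x [^] j)"
      using generate_insert_rcos[OF fin S x, of k] norm k gen' by simp
    then obtain j :: nat where "S #> k = S #> x [^] j" by blast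
    also have "\<dots> = S #> x [^] (j mod q)"
      using q(2)[of q] by (intro rcos_pow_mod_cong[OF S x]) auto
    finally have "S #> k = S #> x [^] (j mod q)" .
    then have "S #> g = S #> (x [^] (j mod q) \<otimes> lprod (take i ws))"
      unfolding k(2) using kG tG x SG by (intro rcos_mult_right_cong) auto
    \<comment> \<open>This prefix consists of \<open>j mod q\<close> full rounds and the first
      \<open>i\<close> letters of the next one.\<close>
    moreover have "x [^] (j mod q) \<otimes> lprod (take i ws) = lprod (take ((j mod q) * length ws + i) ?ws)"
    proof -
      have jq: "j mod q < q" using q by simp
      then have "replicate q ws = replicate (j mod q) ws @ ws # replicate (q - Suc (j mod q)) ws"
        by (simp add: replicate_add[symmetric] replicate_Suc[symmetric] del: replicate_Suc)
      then have "?ws = concat (replicate (j mod q) ws) @ ws @ concat (replicate (q - Suc (j mod q)) ws)"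
        by simp
      moreover have "length (concat (replicate (j mod q) ws)) = (j mod q) * length ws"
        by (simp add: length_concat sum_list_replicate)
      ultimately have "take ((j mod q) * length ws + i) ?ws = concat (replicate (j mod q) ws) @ take i ws"
        using i by simp
      moreover have "set (concat (replicate (j mod q) ws)) \<subseteq> carrier G" using wsG by auto
      ultimately show ?thesis using wsG tG by (simp add: lprod_append lprod_concat_replicate x_def)
    qed
    moreover have "(j mod q) * length ws + i < length ?ws"
    proof -
      have "(j mod q) * length ws + i < Suc (j mod q) * length ws" using i by simp
      also have "\<dots> \<le> q * length ws" using q(1) by (intro mult_le_mono1) (simp add: Suc_le_eq)
      finally show ?thesis using len by simp
    qed
    ultimately show "\<exists>i<length ?ws. g \<in> S #> lprod (take i ?ws)"
      using rcos_mem_iff[OF S g] x tG by (metis lprod_closed m_closed nat_pow_closed)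
  qed
  then show ?thesis by blast
qed

text \<open>Both out-arcs at the coset of \<open>g\<close> lead to the same coset when the conjugate of
  \<open>a b\<inverse>\<close> by \<open>g\<close> lies in K, so the letter used there may be switched.\<close>

lemma coset_tour_switch:
  assumes ab: "a \<in> carrier G" "b \<in> carrier G" and K: "subgroup K G"
    and tour: "coset_tour {a, b} K ws"
    and g: "g \<in> carrier G" and d: "d = g \<otimes> (a \<otimes> inv b) \<otimes> inv g" "d \<in> K"
  obtains ws' k e where "coset_tour {a, b} K ws'" "k \<in> K" "e = d \<or> e = inv d"
    "lprod ws' = k \<otimes> e \<otimes> inv k \<otimes> lprod ws"
proof -
  have ws: "set ws \<subseteq> {a, b}" "length ws * card K = order G" "lprod ws \<in> K"
    and cover: "\<And>g. g \<in> carrier G \<Longrightarrow> \<exists>i<length ws. g \<in> K #> lprod (take i ws)"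
    using tour by (auto simp: coset_tour_def)
  have wsG: "set ws \<subseteq> carrier G" using ws ab by blast
  have tG: "lprod (take j ws) \<in> carrier G" for j using wsG set_take_subset lprod_closed by (metis subset_trans)
  \<comment> \<open>At position \<open>i\<close> the tour stands at the coset of \<open>g\<close>;
    this is where the letter is switched.\<close>
  obtain i where i: "i < length ws" "g \<in> K #> lprod (take i ws)" using cover[OF g] by blast
  then obtain k where k: "k \<in> K" "g = k \<otimes> lprod (take i ws)" by (auto simp: r_coset_def)
  have kG: "k \<in> carrier G" using k K subgroup.mem_carrier by fast
  define p where "p = lprod (take i ws)"
  have pG: "p \<in> carrier G" using tG by (simp add: p_def)
  have p: "p = inv k \<otimes> g" using k(2) kG pG by (simp add: p_def inv_mult_cancel_left)
  define s where "s = ws ! i"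
  have s: "s \<in> {a, b}" using i ws nth_mem by (auto simp: s_def)
  define s' where "s' = (if s = a then b else a)"
  have sG: "s \<in> carrier G" "s' \<in> carrier G" using s ab by (auto simp: s'_def)
  define f where "f = s' \<otimes> inv s"
  have f: "f = a \<otimes> inv b \<or> f = inv (a \<otimes> inv b)"
    using s ab by (auto simp: f_def s'_def inv_mult_group)
  have fG: "f \<in> carrier G" using sG by (simp add: f_def)
  define e where "e = g \<otimes> f \<otimes> inv g"
  have e: "e = d \<or> e = inv d" using f d(1) g ab by (auto simp: e_def word_simps)
  then have eK: "e \<in> K" using d(2) K subgroup.m_inv_closed by fast
  \<comment> \<open>As \<open>g = k \<otimes> p\<close>, conjugating \<open>f\<close> by
    \<open>p\<close> instead of \<open>g\<close> changes the result only by a conjugation inside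
    \<open>K\<close>.\<close>
  have pfp: "p \<otimes> f \<otimes> inv p = inv k \<otimes> e \<otimes> k"
    using kG g fG by (simp add: p e_def word_simps)
  then have pfpK: "p \<otimes> f \<otimes> inv p \<in> K" using eK k(1) K subgroup.m_closed subgroup.m_inv_closed by metis
  define ws' where "ws' = ws[i := s']"
  have short: "take j ws' = take j ws" if "j \<le> i" for j using that by (simp add: ws'_def)
  \<comment> \<open>Every prefix product beyond position \<open>i\<close> gains one left factor from
    \<open>K\<close>, so none of the cosets visited changes.\<close>
  have long: "lprod (take j ws') = (p \<otimes> f \<otimes> inv p) \<otimes> lprod (take j ws)" if j: "i < j" for j
  proof -
    define t where "t = take (j - Suc i) (drop (Suc i) ws)"
    have tG': "set t \<subseteq> carrier G"
      using wsG set_take_subset set_drop_subset unfolding t_def by (metis subset_trans)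
    have piG: "set (take i ws) \<subseteq> carrier G" using wsG set_take_subset by fast
    have "ws = take i ws @ s # drop (Suc i) ws" using i by (simp add: s_def id_take_nth_drop)
    then have "take j ws = take j (take i ws @ s # drop (Suc i) ws)" by simp
    also have "\<dots> = take i ws @ s # t" using i j by (simp add: t_def min_def take_Cons')
    finally have 1: "take j ws = take i ws @ s # t" .
    have "ws' = take i ws @ s' # drop (Suc i) ws" using i by (simp add: ws'_def upd_conv_take_nth_drop)
    then have "take j ws' = take j (take i ws @ s' # drop (Suc i) ws)" by simp
    also have "\<dots> = take i ws @ s' # t" using i j by (simp add: t_def min_def take_Cons')
    finally have 2: "take j ws' = take i ws @ s' # t" .
    show ?thesis unfolding 1 2 using piG tG' sG pG
      by (simp add: lprod_append p_def[symmetric] f_def word_simps)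
  qed
  have len: "length ws' = length ws" by (simp add: ws'_def)
  have whole: "lprod ws' = (p \<otimes> f \<otimes> inv p) \<otimes> lprod ws"
    using long[of "length ws"] i len by simp
  have "coset_tour {a, b} K ws'"
    unfolding coset_tour_def
  proof (intro conjI ballI)
    show "set ws' \<subseteq> {a, b}" using ws s by (auto simp: ws'_def s'_def dest!: set_update_subset_insert[THEN subsetD])
    show "length ws' * card K = order G" using ws len by simp
    show "lprod ws' \<in> K" using whole pfpK ws K subgroup.m_closed by metis
    fix h assume h: "h \<in> carrier G"
    then obtain j where j: "j < length ws" "h \<in> K #> lprod (take j ws)" using cover by blast
    have "K #> lprod (take j ws') = K #> lprod (take j ws)"
    proof (cases "j \<le> i")
      case False
      then show ?thesis
        using long[of j] pfpK K tG pG fG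
        by (simp add: coset_mult_assoc[symmetric] coset_join2 subgroup.subset del: coset_mult_assoc)
    qed (use short in simp)
    then show "\<exists>i<length ws'. h \<in> K #> lprod (take i ws')" using j len by auto
  qed
  moreover have "lprod ws' = inv k \<otimes> e \<otimes> inv (inv k) \<otimes> lprod ws" using whole pfp kG by simp
  ultimately show ?thesis using that[of ws' "inv k" e] e k(1) K subgroup.m_inv_closed by metis
qed


subsection \<open>Descent through subgroups generated by conjugates\<close>

text \<open>The conjugators range over all of \<open>carrier G\<close>, not only over
  \<open>K\<close>: a tour meets every coset of \<open>K\<close>, so a letter can be switched at the
  coset of any \<open>g\<close> whose conjugate of \<open>c\<close> lies in
  \<open>K\<close>.\<close>

definition conjs :: "'a \<Rightarrow> 'a set \<Rightarrow> 'a set" where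
  "conjs c K = {g \<otimes> c \<otimes> inv g | g. g \<in> carrier G} \<inter> K"

lemma conjs_conj:
  assumes "c \<in> carrier G" "K \<subseteq> carrier G" "y \<in> conjs c K" "k \<in> carrier G" "k \<otimes> y \<otimes> inv k \<in> K'"
  shows "k \<otimes> y \<otimes> inv k \<in> conjs c K'"
proof -
  obtain g where g: "g \<in> carrier G" "y = g \<otimes> c \<otimes> inv g" using assms by (auto simp: conjs_def)
  then have "k \<otimes> y \<otimes> inv k = (k \<otimes> g) \<otimes> c \<otimes> inv (k \<otimes> g)" using assms by (simp add: word_simps)
  then show ?thesis using assms g unfolding conjs_def by blast
qed

definition normal_closure_in :: "'a set \<Rightarrow> 'a set \<Rightarrow> 'a set" where
  "normal_closure_in K X = generate G {k \<otimes> x \<otimes> inv k | k x. k \<in> K \<and> x \<in> X}"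

text \<open>Normality is checked on the generators, where conjugating by \<open>k\<close> replaces
  the conjugator \<open>l\<close> by \<open>k \<otimes> l\<close>.\<close>

lemma normal_closure_in:
  assumes K: "subgroup K G" and X: "X \<subseteq> K"
  shows "subgroup (normal_closure_in K X) G"
    and "X \<subseteq> normal_closure_in K X"
    and "normal_closure_in K X \<subseteq> K"
    and "\<And>k m. \<lbrakk>k \<in> K; m \<in> normal_closure_in K X\<rbrakk> \<Longrightarrow> k \<otimes> m \<otimes> inv k \<in> normal_closure_in K X"
proof -
  let ?Y = "{k \<otimes> x \<otimes> inv k | k x. k \<in> K \<and> x \<in> X}"
  have KG: "K \<subseteq> carrier G" using K subgroup.subset by blast
  have YK: "?Y \<subseteq> K"
    using X subgroup.m_closed[OF K] subgroup.m_inv_closed[OF K] by blast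
  then have YG: "?Y \<subseteq> carrier G" using KG by blast
  show sub: "subgroup (normal_closure_in K X) G"
    unfolding normal_closure_in_def using YG by (rule generate_is_subgroup)
  show "normal_closure_in K X \<subseteq> K"
    unfolding normal_closure_in_def using generate_subgroup_incl[OF YK K] .
  have "x \<in> ?Y" if x: "x \<in> X" for x
  proof -
    have "x = \<one> \<otimes> x \<otimes> inv \<one>" using x X KG by auto
    then show ?thesis using x subgroup.one_closed[OF K] by blast
  qed
  then show "X \<subseteq> normal_closure_in K X"
    unfolding normal_closure_in_def by (blast intro: generate.incl)
  fix k m assume k: "k \<in> K" and m: "m \<in> normal_closure_in K X"
  have kG: "k \<in> carrier G" using k KG by blast
  from m show "k \<otimes> m \<otimes> inv k \<in> normal_closure_in K X"
    unfolding normal_closure_in_def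
  proof (induction m)
    case one
    then show ?case using kG by (simp add: generate.one)
  next
    case (incl h)
    then obtain l x where l: "l \<in> K" "x \<in> X" "h = l \<otimes> x \<otimes> inv l" by blast
    then have "k \<otimes> h \<otimes> inv k = (k \<otimes> l) \<otimes> x \<otimes> inv (k \<otimes> l)"
      using kG KG X by (simp add: word_simps subset_iff)
    then show ?case using l k subgroup.m_closed[OF K] by (blast intro: generate.incl)
  next
    case (inv h)
    then obtain l x where l: "l \<in> K" "x \<in> X" "h = l \<otimes> x \<otimes> inv l" by blast
    then have "k \<otimes> inv h \<otimes> inv k = inv ((k \<otimes> l) \<otimes> x \<otimes> inv (k \<otimes> l))"
      using kG KG X by (simp add: word_simps subset_iff)
    moreover have "(k \<otimes> l) \<otimes> x \<otimes> inv (k \<otimes> l) \<in> ?Y" using l k subgroup.m_closed[OF K] by blast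
    ultimately show ?case by (simp only: generate.inv)
  next
    case (eng h1 h2)
    have "h1 \<in> carrier G" "h2 \<in> carrier G" using eng generate_in_carrier[OF YG] by auto
    then have "k \<otimes> (h1 \<otimes> h2) \<otimes> inv k = (k \<otimes> h1 \<otimes> inv k) \<otimes> (k \<otimes> h2 \<otimes> inv k)"
      using kG by (simp add: word_simps)
    then show ?case using generate.eng[OF eng.IH] by simp
  qed
qed

text \<open>Conjugating a conjugate of \<open>c\<close> gives another one. This keeps the descent
  among subgroups generated by conjugates of \<open>c\<close>.\<close>

lemma normal_closure_in_conjs:
  assumes c: "c \<in> carrier G" and K: "subgroup K G" and X: "X \<subseteq> conjs c K"
  shows "generate G (conjs c (normal_closure_in K X)) = normal_closure_in K X"
proof
  have XK: "X \<subseteq> K" using X by (auto simp: conjs_def)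
  note N = normal_closure_in[OF K XK]
  have KG: "K \<subseteq> carrier G" using K subgroup.subset by blast
  show "generate G (conjs c (normal_closure_in K X)) \<subseteq> normal_closure_in K X"
    by (rule generate_subgroup_incl[OF _ N(1)]) (auto simp: conjs_def)
  have "{k \<otimes> x \<otimes> inv k | k x. k \<in> K \<and> x \<in> X} \<subseteq> conjs c (normal_closure_in K X)"
  proof clarify
    fix k x assume kx: "k \<in> K" "x \<in> X"
    show "k \<otimes> x \<otimes> inv k \<in> conjs c (normal_closure_in K X)"
    proof (rule conjs_conj[OF c KG])
      show "x \<in> conjs c K" using kx X by blast
      show "k \<in> carrier G" using kx KG by blast
      show "k \<otimes> x \<otimes> inv k \<in> normal_closure_in K X" using N(2) N(4)[OF kx(1)] kx(2) by blast
    qed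
  qed
  then show "normal_closure_in K X \<subseteq> generate G (conjs c (normal_closure_in K X))"
    by (subst normal_closure_in_def) (rule mono_generate)
qed

section \<open>Prime parts of elements and one step of the descent\<close>

lemma pow_eq_of_cong_order:
  assumes "finite (carrier G)" "x \<in> carrier G" "[m = n] (mod order G)"
  shows "x [^] (m::nat) = x [^] n"
proof -
  have red: "x [^] (m::nat) = x [^] (m mod order G)" for m
  proof -
    have "x [^] m = (x [^] order G) [^] (m div order G) \<otimes> x [^] (m mod order G)"
      using assms(2) by (simp add: nat_pow_pow nat_pow_mult)
    then show ?thesis using assms(2) by (simp add: pow_order_eq_1)
  qed
  show ?thesis using red[of m] red[of n] assms(3) by (simp add: cong_def)
qed

text \<open>The powers with exponents s and t are the p-part and the p'-part of an element.\<close>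

lemma order_split_prime:
  assumes fin: "finite (carrier G)" and p: "prime (p::nat)"
  obtains e r s t :: nat where "order G = p ^ e * r" "coprime (p ^ e) r" "\<not> p dvd r"
    "[s = 1] (mod p ^ e)" "r dvd s" "p ^ e dvd t" "[s + t = 1] (mod order G)"
proof -
  have "order G > 0" using fin order_gt_0_iff_finite by blast
  moreover have "\<not> is_unit p" using p by auto
  ultimately obtain r where r: "order G = p ^ multiplicity p (order G) * r" "\<not> p dvd r"
    using multiplicity_decompose'[of "order G" p] by blast
  define e where "e = multiplicity p (order G)"
  have cop: "coprime (p ^ e) r" using r(2) p by (simp add: prime_imp_coprime)
  obtain s where s: "[s = 1] (mod p ^ e)" "[s = 0] (mod r)"
    using binary_chinese_remainder_nat[OF cop] by blast
  obtain t where t: "[t = 0] (mod p ^ e)" "[t = 1] (mod r)"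
    using binary_chinese_remainder_nat[OF cop] by blast
  have "[s + t = 1 + 0] (mod p ^ e)" "[s + t = 0 + 1] (mod r)" using s t by (blast intro: cong_add)+
  then have "[s + t = 1] (mod p ^ e * r)"
    using coprime_cong_mult_nat[OF _ _ cop] by simp
  then show ?thesis
    using that[of e r s t] r cop s t by (simp add: e_def cong_0_iff)
qed

text \<open>Replacing a conjugate of c outside S by the conjugate under the p-part of the same
  conjugator makes its order modulo S a power of p.\<close>

lemma conjugate_prime_part:
  assumes nil: "nilpotent G" and fin: "finite (carrier G)" and c: "c \<in> carrier G"
    and K: "subgroup K G" and S: "subgroup S G" and cS: "c \<in> S" and SK: "S \<subseteq> K"
    and norm: "\<And>k m. k \<in> K \<Longrightarrow> m \<in> S \<Longrightarrow> k \<otimes> m \<otimes> inv k \<in> S"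
    and d: "d \<in> conjs c K" "d \<notin> S"
  obtains d' and p e :: nat where "d' \<in> conjs c K" "d' \<notin> S" "prime p" "e > 0" "d' [^] (p ^ e) \<in> S"
proof -
  obtain g where g: "g \<in> carrier G" "d = g \<otimes> c \<otimes> inv g" and dK: "d \<in> K"
    using d by (auto simp: conjs_def)
  have dG: "d \<in> carrier G" using g c by simp
  obtain k where k: "k > 0" "\<And>j::nat. d [^] j \<in> S \<longleftrightarrow> k dvd j"
    using pow_mem_iff_dvd[OF fin S dG] by blast
  have "k \<noteq> 1" using k(2)[of 1] d dG by auto
  \<comment> \<open>\<open>k\<close> is the order of \<open>d\<close> modulo \<open>S\<close>; any
    of its prime divisors will do.\<close>
  then obtain p where p: "prime p" "p dvd k" using prime_factor_nat by blast
  obtain e r s t :: nat where o: "order G = p ^ e * r" "coprime (p ^ e) r" "\<not> p dvd r"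
    "[s = 1] (mod p ^ e)" "r dvd s" "p ^ e dvd t" "[s + t = 1] (mod order G)"
    using order_split_prime[OF fin p(1)] by blast
  have "k dvd order G"
    using k(2)[of "order G"] pow_order_eq_1[OF dG] S by (simp add: subgroup.one_closed)
  then have "p dvd p ^ e * r" using p o by (metis dvd_trans)
  then have e: "e > 0" using o(3) p(1) by (cases e) auto
  have ps: "\<not> p dvd s"
  proof
    assume "p dvd s"
    moreover have "[s = 1] (mod p)" using o(4) e by (rule_tac cong_dvd_modulus_nat) auto
    ultimately have "p dvd 1" using cong_dvd_iff by blast
    then show False using p(1) by auto
  qed
  have st: "y [^] s \<otimes> y [^] t = y" if "y \<in> carrier G" for y
    using pow_eq_of_cong_order[OF fin that o(7)] that by (simp add: nat_pow_mult)
  have s1: "(y [^] s) [^] (p ^ e) = \<one>" if "y \<in> carrier G" for y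
  proof -
    have "order G dvd s * p ^ e" using o(1,5) by (simp add: mult.commute mult_dvd_mono)
    then have "[s * p ^ e = 0] (mod order G)" by (simp add: cong_0_iff)
    then show ?thesis using pow_eq_of_cong_order[OF fin that] that by (simp add: nat_pow_pow)
  qed
  have t1: "(y [^] t) [^] r = \<one>" if "y \<in> carrier G" for y
  proof -
    have "order G dvd t * r" using o(1,6) by (simp add: mult_dvd_mono)
    then have "[t * r = 0] (mod order G)" by (simp add: cong_0_iff)
    then show ?thesis using pow_eq_of_cong_order[OF fin that] that by (simp add: nat_pow_pow)
  qed
  \<comment> \<open>Parts of coprime orders commute, even when they come from different
    elements.\<close>
  have comm: "y [^] s \<otimes> z [^] t = z [^] t \<otimes> y [^] s" if "y \<in> carrier G" "z \<in> carrier G" for y z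
    using nilpotent_coprime_commute[OF nil fin _ _ s1 t1 o(2)] that by simp
  \<comment> \<open>Since \<open>g [^] t\<close> commutes with \<open>c [^] s\<close>, the power
    \<open>d [^] s\<close> is the conjugate of \<open>c [^] s\<close> by \<open>g [^] s\<close>.
    Since \<open>c [^] t\<close> commutes with \<open>g [^] s\<close>, it follows that
    \<open>d' = d [^] s \<otimes> c [^] t\<close>, so \<open>d'\<close> agrees with
    \<open>d [^] s\<close> modulo \<open>S\<close>.\<close>
  define d' where "d' = g [^] s \<otimes> c \<otimes> inv (g [^] s)"
  have d'G: "d' \<in> carrier G" using g c by (simp add: d'_def)
  have "d [^] s = g \<otimes> c [^] s \<otimes> inv g" using conj_pow[OF g(1) c] g(2) by simp
  also have "\<dots> = (g [^] s \<otimes> g [^] t) \<otimes> c [^] s \<otimes> inv (g [^] s \<otimes> g [^] t)" using st[OF g(1)] by simp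
  also have "\<dots> = g [^] s \<otimes> (g [^] t \<otimes> c [^] s) \<otimes> inv (g [^] t) \<otimes> inv (g [^] s)"
    using g c by (simp add: word_simps)
  also have "\<dots> = g [^] s \<otimes> c [^] s \<otimes> inv (g [^] s)"
    unfolding comm[OF c g(1), symmetric] using g c by (simp add: word_simps)
  finally have ds: "d [^] s = g [^] s \<otimes> c [^] s \<otimes> inv (g [^] s)" .
  have "d' = g [^] s \<otimes> (c [^] s \<otimes> c [^] t) \<otimes> inv (g [^] s)" using st[OF c] by (simp add: d'_def)
  also have "\<dots> = g [^] s \<otimes> c [^] s \<otimes> (inv (g [^] s) \<otimes> (g [^] s \<otimes> c [^] t)) \<otimes> inv (g [^] s)"
    using g c by (simp add: word_simps)
  also have "\<dots> = d [^] s \<otimes> c [^] t"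
    unfolding comm[OF g(1) c] ds using g c by (simp add: word_simps)
  finally have d': "d' = d [^] s \<otimes> c [^] t" .
  have ctS: "c [^] t \<in> S" using pow_mem_subgroup[OF S cS] .
  have dsK: "d [^] s \<in> K" using pow_mem_subgroup[OF K dK] .
  have "d' \<in> K" using d' dsK ctS SK subgroup.m_closed[OF K] by auto
  then have "d' \<in> conjs c K" using g(1) by (auto simp: conjs_def d'_def)
  \<comment> \<open>Otherwise \<open>d [^] s\<close> would lie in \<open>S\<close>, and
    \<open>k\<close>, hence \<open>p\<close>, would divide \<open>s\<close>, which is 1 modulo
    \<open>p\<close>.\<close>
  moreover have "d' \<notin> S"
  proof
    assume "d' \<in> S"
    then have "d' \<otimes> inv (c [^] t) \<in> S" using ctS S subgroup.m_closed subgroup.m_inv_closed by metis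
    then have "d [^] s \<in> S" using d' c dG by (simp add: word_simps)
    then show False using k(2) p(2) ps dvd_trans by blast
  qed
  moreover have "d' [^] (p ^ e) \<in> S"
  proof -
    have "S #> (d [^] s \<otimes> c [^] t) = S #> (d [^] s \<otimes> \<one>)"
      using S dG c norm[OF dsK] ctS by (intro rcos_mult_left_cong) (auto simp: coset_join2 subgroup.subset)
    then have "S #> d [^] s = S #> d'" using d' dG by simp
    then have "S #> (d [^] s) [^] (p ^ e) = S #> d' [^] (p ^ e)"
      using S dG d'G norm[OF dsK] by (intro rcos_pow_cong) auto
    then have "S #> d' [^] (p ^ e) = S" using s1[OF dG] S by (simp add: subgroup.subset)
    then show ?thesis using coset_join1 S d'G by blast
  qed
  ultimately show ?thesis using that p(1) e by blast
qed

text \<open>\<open>S\<close> is maximal among the proper subgroups of \<open>K\<close> that contain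
  \<open>c\<close>, are generated by conjugates of \<open>c\<close> and are normal in
  \<open>K\<close>; the normal closure of \<open>c\<close> in \<open>K\<close> is one of them. Some
  conjugate of \<open>c\<close> in \<open>K\<close> lies outside \<open>S\<close>, and its
  modification \<open>d\<close> has prime power order modulo \<open>S\<close>. By maximality
  \<open>d\<close> and \<open>S\<close> have normal closure \<open>K\<close>, so by nilpotency they
  generate \<open>K\<close>.\<close>

lemma conj_generated_descent:
  assumes nil: "nilpotent G" and fin: "finite (carrier G)" and c: "c \<in> carrier G"
    and K: "subgroup K G" and cK: "c \<in> K" and gen: "generate G (conjs c K) = K"
    and ne: "K \<noteq> generate G {c}"
  obtains S d and p e :: nat where "subgroup S G" "c \<in> S" "S \<subset> K" "generate G (conjs c S) = S"
    "\<And>k m. k \<in> K \<Longrightarrow> m \<in> S \<Longrightarrow> k \<otimes> m \<otimes> inv k \<in> S"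
    "d \<in> conjs c K" "d \<notin> S" "generate G (insert d S) = K" "prime p" "e > 0" "d [^] (p ^ e) \<in> S"
proof -
  define F where "F = {S. subgroup S G \<and> c \<in> S \<and> S \<subset> K \<and> generate G (conjs c S) = S \<and>
     (\<forall>k\<in>K. \<forall>m\<in>S. k \<otimes> m \<otimes> inv k \<in> S)}"
  have KG: "K \<subseteq> carrier G" using K subgroup.subset by blast
  have inF: "normal_closure_in K X \<in> F"
    if X: "X \<subseteq> conjs c K" and cX: "c \<in> normal_closure_in K X" and ne: "normal_closure_in K X \<noteq> K" for X
  proof -
    have "X \<subseteq> K" using X by (auto simp: conjs_def)
    note N = normal_closure_in[OF K this]
    show ?thesis unfolding F_def using N cX ne normal_closure_in_conjs[OF c K X] by blast
  qed
  \<comment> \<open>Used twice: with \<open>generate G {c}\<close> to show that \<open>F\<close> is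
    not empty, and at the end to show that \<open>d\<close> generates \<open>K\<close> modulo
    \<open>S\<close>.\<close>
  have closure_proper: "M = K"
    if "subgroup M G" "M \<subseteq> K" "X \<subseteq> M" "normal_closure_in K X = K" for M X
  proof (rule nilpotent_normal_closure_eq[OF nil that(1) K that(2)])
    have "{k \<otimes> x \<otimes> inv k | k x. k \<in> K \<and> x \<in> X} \<subseteq> {k \<otimes> x \<otimes> inv k | k x. k \<in> K \<and> x \<in> M}"
      using that(3) by blast
    then show "K \<subseteq> generate G {k \<otimes> m \<otimes> inv k | k m. k \<in> K \<and> m \<in> M}"
      using that(4) mono_generate unfolding normal_closure_in_def by blast
  qed
  have cc: "c \<in> conjs c K"
  proof -
    have "c = \<one> \<otimes> c \<otimes> inv \<one>" using c by simp
    then show ?thesis using cK unfolding conjs_def by blast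
  qed
  have "normal_closure_in K {c} \<in> F"
  proof (rule inF)
    show "{c} \<subseteq> conjs c K" using cc by simp
    show "c \<in> normal_closure_in K {c}" using normal_closure_in(2)[OF K, of "{c}"] cK by simp
    show "normal_closure_in K {c} \<noteq> K"
      using closure_proper[of "generate G {c}" "{c}"] ne c cK
        generate_is_subgroup[of "{c}"] generate_subgroup_incl[OF _ K, of "{c}"] generate.incl[of c "{c}" G] by auto
  qed
  moreover have "finite F"
  proof (rule finite_subset)
    show "F \<subseteq> Pow (carrier G)" using KG by (auto simp: F_def)
  qed (use fin in simp)
  ultimately obtain S where S: "S \<in> F" and max: "\<And>T. \<lbrakk>T \<in> F; S \<subseteq> T\<rbrakk> \<Longrightarrow> S = T"
    using finite_has_maximal[of F] by (metis empty_iff)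
  have S': "subgroup S G" "c \<in> S" "S \<subset> K" "generate G (conjs c S) = S"
    and norm: "\<And>k m. k \<in> K \<Longrightarrow> m \<in> S \<Longrightarrow> k \<otimes> m \<otimes> inv k \<in> S"
    using S by (auto simp: F_def)
  have SK: "S \<subseteq> K" using S' by blast
  have "\<not> conjs c K \<subseteq> S"
    using generate_subgroup_incl[OF _ S'(1)] gen S'(3) by blast
  then obtain d0 where "d0 \<in> conjs c K" "d0 \<notin> S" by blast
  then obtain d and p e :: nat
    where d: "d \<in> conjs c K" "d \<notin> S" and pe: "prime p" "e > 0" "d [^] (p ^ e) \<in> S"
    using conjugate_prime_part[OF nil fin c K S'(1,2) SK norm] by blast
  have dK: "d \<in> K" using d by (simp add: conjs_def)
  \<comment> \<open>Taking \<open>conjs c S\<close> in place of \<open>S\<close> makes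
    \<open>X\<close> a set of conjugates of \<open>c\<close>, so that its normal closure would
    belong to \<open>F\<close> if it were proper.\<close>
  define X where "X = insert d (conjs c S)"
  have X: "X \<subseteq> conjs c K" using d SK by (auto simp: X_def conjs_def)
  then have XK: "X \<subseteq> K" by (auto simp: conjs_def)
  note N = normal_closure_in[OF K XK]
  have SN: "S \<subseteq> normal_closure_in K X"
    using generate_subgroup_incl[OF _ N(1), of "conjs c S"] N(2) S'(4) by (auto simp: X_def)
  have dN: "d \<in> normal_closure_in K X" using N(2) by (auto simp: X_def)
  have "normal_closure_in K X = K"
  proof (rule ccontr)
    assume "normal_closure_in K X \<noteq> K"
    then have "normal_closure_in K X \<in> F" using inF[OF X] SN S'(2) by blast
    then show False using max[OF _ SN] dN d(2) by blast
  qed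
  moreover have "subgroup (generate G (insert d S)) G"
    using dK SK KG by (intro generate_is_subgroup) blast
  moreover have "generate G (insert d S) \<subseteq> K"
    using generate_subgroup_incl[OF _ K] dK SK by auto
  moreover have "X \<subseteq> generate G (insert d S)"
    by (auto simp: X_def conjs_def intro: generate.incl)
  ultimately have "generate G (insert d S) = K" using closure_proper by blast
  then show ?thesis using that S' norm d pe by blast
qed

section \<open>Tours whose product generates the quotient\<close>

text \<open>With \<open>j\<close> an inverse of \<open>i\<close> modulo \<open>q\<close>, the power
  \<open>y [^] j\<close> lies in the coset of \<open>d\<close>, so \<open>y\<close> and
  \<open>S\<close> generate \<open>d\<close>.\<close>

lemma generate_insert_coprime_pow:
  assumes fin: "finite (carrier G)" and S: "subgroup S G" and K: "subgroup K G" and SK: "S \<subseteq> K"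
    and norm: "\<And>k m. k \<in> K \<Longrightarrow> m \<in> S \<Longrightarrow> k \<otimes> m \<otimes> inv k \<in> S"
    and d: "d \<in> K" "generate G (insert d S) = K" and q: "d [^] (q::nat) \<in> S"
    and y: "y \<in> K" "S #> y = S #> d [^] (i::nat)" and cop: "coprime i q"
  shows "generate G (insert y S) = K"
proof -
  have KG: "K \<subseteq> carrier G" using K subgroup.subset by blast
  have G: "d \<in> carrier G" "y \<in> carrier G" using d y KG by auto
  let ?M = "generate G (insert y S)"
  have M: "subgroup ?M G" using y SK KG by (intro generate_is_subgroup) blast
  have MK: "?M \<subseteq> K" using generate_subgroup_incl[OF _ K, of "insert y S"] y SK by auto
  have SM: "S \<subseteq> ?M" and yM: "y \<in> ?M" by (auto intro: generate.incl)
  obtain j where j: "[i * j = 1] (mod q)" using cong_solve_coprime_nat[OF cop] by auto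
  have "S #> y [^] j = S #> (d [^] i) [^] j"
    using S G norm[OF y(1)] y(2) by (intro rcos_pow_cong) auto
  also have "\<dots> = S #> d [^] (1::nat)"
    using rcos_pow_mod_cong[OF S G(1) q j] G by (simp add: nat_pow_pow)
  finally have "S #> d = S #> y [^] j" using G by simp
  then have "d \<in> S #> y [^] j" using rcos_mem_iff[OF S] G by simp
  then have "d \<in> ?M"
    using SM pow_mem_subgroup[OF M yM] subgroup.m_closed[OF M] by (auto simp: r_coset_def)
  then have "K \<subseteq> ?M" using generate_subgroup_incl[OF _ M, of "insert d S"] SM d(2) by auto
  then show ?thesis using MK by blast
qed

text \<open>Writing \<open>k = m \<otimes> d [^] j\<close> with \<open>m \<in> S\<close>, the power
  of \<open>d\<close> commutes with \<open>e\<close>, and conjugation by \<open>m\<close> does not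
  move the coset of \<open>e\<close> because \<open>e\<close> normalises \<open>S\<close>.\<close>

lemma rcos_conj_pow_self:
  assumes S: "subgroup S G" and d: "d \<in> carrier G" and k: "k \<in> carrier G" "S #> k = S #> d [^] (j::nat)"
    and norm: "\<And>m. m \<in> S \<Longrightarrow> e \<otimes> m \<otimes> inv e \<in> S" and e: "e = d \<or> e = inv d"
  shows "S #> (k \<otimes> e \<otimes> inv k) = S #> e"
proof -
  have eG: "e \<in> carrier G" using e d by auto
  have "k \<in> S #> d [^] j" using rcos_mem_iff[OF S k(1)] d k(2) by simp
  then obtain m where m: "m \<in> S" "k = m \<otimes> d [^] j" by (auto simp: r_coset_def)
  have mG: "m \<in> carrier G" using m S subgroup.mem_carrier by fast
  have dd: "d [^] j \<otimes> d = d \<otimes> d [^] j" using nat_pow_comm[OF d, of j 1] d by simp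
  have de: "d [^] j \<otimes> e = e \<otimes> d [^] j"
  proof (cases "e = d")
    case False
    then have [simp]: "e = inv d" using e by blast
    have "inv d \<otimes> (d [^] j \<otimes> d) \<otimes> inv d = inv d \<otimes> (d \<otimes> d [^] j) \<otimes> inv d" using dd by simp
    then show ?thesis using d by (simp add: word_simps)
  qed (use dd in simp)
  have "k \<otimes> e \<otimes> inv k = m \<otimes> (d [^] j \<otimes> e) \<otimes> inv (d [^] j) \<otimes> inv m"
    using m mG d eG by (simp add: word_simps)
  also have "\<dots> = m \<otimes> e \<otimes> inv m" unfolding de using mG d eG by (simp add: word_simps)
  finally have ke: "k \<otimes> e \<otimes> inv k = m \<otimes> e \<otimes> inv m" .
  have "m \<otimes> (e \<otimes> inv m \<otimes> inv e) \<in> S"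
    using m S norm subgroup.m_closed subgroup.m_inv_closed by metis
  then have "(m \<otimes> e \<otimes> inv m) \<otimes> inv e \<in> S" using mG eG by (simp add: m_assoc)
  then show ?thesis using rcos_eq_iff[OF S] mG eG ke by simp
qed

text \<open>If the product of a tour fails to generate K modulo S, where the quotient is a cyclic
  p-group, switching one letter changes its exponent by one and so repairs this.\<close>

lemma coset_tour_generating:
  assumes fin: "finite (carrier G)" and ab: "a \<in> carrier G" "b \<in> carrier G" and c: "c = a \<otimes> inv b"
    and S: "subgroup S G" and K: "subgroup K G" and SK: "S \<subseteq> K"
    and norm: "\<And>k m. k \<in> K \<Longrightarrow> m \<in> S \<Longrightarrow> k \<otimes> m \<otimes> inv k \<in> S"
    and d: "d \<in> conjs c K" "generate G (insert d S) = K"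
    and p: "prime (p::nat)" "e > 0" "d [^] (p ^ e) \<in> S"
    and tour: "coset_tour {a, b} K ws"
  obtains ws' where "coset_tour {a, b} K ws'" "generate G (insert (lprod ws') S) = K"
proof -
  have KG: "K \<subseteq> carrier G" using K subgroup.subset by blast
  obtain g where g: "g \<in> carrier G" "d = g \<otimes> (a \<otimes> inv b) \<otimes> inv g" and dK: "d \<in> K"
    using d(1) c by (auto simp: conjs_def)
  have dG: "d \<in> carrier G" using dK KG by blast
  have expo: "\<exists>j::nat. S #> z = S #> d [^] j" if "z \<in> K" for z
    using generate_insert_rcos[OF fin S dG, of z] norm that d(2) by simp
  have good: "generate G (insert y S) = K" if "y \<in> K" "S #> y = S #> d [^] i" "\<not> p dvd i" for y and i :: nat
  proof (rule generate_insert_coprime_pow[OF fin S K SK norm dK d(2) p(3) that(1,2)])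
    show "coprime i (p ^ e)" using prime_imp_coprime[OF p(1) that(3)] by (simp add: coprime_commute)
  qed
  define x where "x = lprod ws"
  have xK: "x \<in> K" using tour by (simp add: coset_tour_def x_def)
  have xG: "x \<in> carrier G" using xK KG by blast
  obtain i0 :: nat where i0: "S #> x = S #> d [^] i0" using expo[OF xK] by blast
  \<comment> \<open>Adding \<open>p ^ e\<close> keeps the coset and makes the exponent positive, so
    that \<open>i - 1\<close> is a true predecessor.\<close>
  define i where "i = i0 + p ^ e"
  have i: "S #> x = S #> d [^] i" "i > 0"
    using i0 rcos_pow_mod_cong[OF S dG p(3), of i i0] prime_gt_0_nat[OF p(1)] by (auto simp: i_def cong_def)
  show ?thesis
  proof (cases "p dvd i")
    case False
    then show ?thesis using that[OF tour] good[OF xK i(1)] by (simp add: x_def)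
  next
    case True
    obtain ws' k f where ws': "coset_tour {a, b} K ws'" and k: "k \<in> K" and f: "f = d \<or> f = inv d"
      and prod: "lprod ws' = k \<otimes> f \<otimes> inv k \<otimes> x"
      using coset_tour_switch[OF ab K tour g dK] by (metis x_def)
    have kG: "k \<in> carrier G" using k KG by blast
    have fK: "f \<in> K" using f dK K subgroup.m_inv_closed by fast
    have fG: "f \<in> carrier G" using fK KG by blast
    have yK: "lprod ws' \<in> K" using ws' by (simp add: coset_tour_def)
    obtain j :: nat where j: "S #> k = S #> d [^] j" using expo[OF k] by blast
    have SG: "S \<subseteq> carrier G" using SK KG by blast
    \<comment> \<open>The quotient is abelian, so the conjugation by \<open>k\<close> disappears
      modulo \<open>S\<close>.\<close>
    have "S #> lprod ws' = S #> (f \<otimes> x)"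
      unfolding prod using rcos_conj_pow_self[OF S dG kG j norm[OF fK] f] kG fG xG SG
      by (intro rcos_mult_right_cong) auto
    also have "\<dots> = S #> (f \<otimes> d [^] i)"
      using S xG dG fG norm[OF fK] i(1) by (intro rcos_mult_left_cong) auto
    finally have y: "S #> lprod ws' = S #> (f \<otimes> d [^] i)" .
    \<comment> \<open>As \<open>p\<close> divides \<open>i\<close>, it divides neither
      \<open>Suc i\<close> nor \<open>i - 1\<close>, the two possible new exponents.\<close>
    have p1: "\<not> p dvd 1" using p(1) by auto
    show ?thesis
    proof (cases "f = d")
      case True
      have "f \<otimes> d [^] i = d [^] Suc i" using True dG by (simp add: nat_pow_Suc2[symmetric] del: nat_pow_Suc)
      moreover have "\<not> p dvd Suc i" using \<open>p dvd i\<close> p1 by (metis dvd_add_right_iff plus_1_eq_Suc add.commute)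
      ultimately show ?thesis using that[OF ws'] good[OF yK] y by metis
    next
      case False
      then have "f = inv d" using f by blast
      moreover have "d [^] i = d \<otimes> d [^] (i - 1)"
        using i(2) dG nat_pow_Suc2[of d "i - 1"] by simp
      ultimately have "f \<otimes> d [^] i = d [^] (i - 1)" using dG by (simp add: inv_mult_cancel_left)
      moreover have "\<not> p dvd (i - 1)"
      proof
        assume "p dvd (i - 1)"
        then have "p dvd i - (i - 1)" using \<open>p dvd i\<close> by (rule_tac dvd_diff_nat)
        then show False using i(2) p1 by simp
      qed
      ultimately show ?thesis using that[OF ws'] good[OF yK] y by metis
    qed
  qed
qed

text \<open>Induction on \<open>card K\<close>: a tour whose product generates \<open>K\<close>
  modulo \<open>S\<close> lifts to \<open>S\<close>, which is smaller and satisfies the same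
  hypotheses.\<close>

lemma coset_tour_descent:
  assumes nil: "nilpotent G" and fin: "finite (carrier G)"
    and ab: "a \<in> carrier G" "b \<in> carrier G" and c: "c = a \<otimes> inv b"
    and "subgroup K G" and "c \<in> K" and "generate G (conjs c K) = K" and "coset_tour {a, b} K ws"
  shows "\<exists>ws. coset_tour {a, b} (generate G {c}) ws"
  using assms(6-)
proof (induction "card K" arbitrary: K ws rule: less_induct)
  case less
  have cG: "c \<in> carrier G" using ab c by simp
  note K = less.prems(1)
  show ?case
  proof (cases "K = generate G {c}")
    case True
    then show ?thesis using less.prems by blast
  next
    case False
    obtain S d and p e :: nat where S: "subgroup S G" "c \<in> S" "S \<subset> K" "generate G (conjs c S) = S"
      and norm: "\<And>k m. k \<in> K \<Longrightarrow> m \<in> S \<Longrightarrow> k \<otimes> m \<otimes> inv k \<in> S"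
      and d: "d \<in> conjs c K" "d \<notin> S" "generate G (insert d S) = K"
      and p: "prime p" "e > 0" "d [^] (p ^ e) \<in> S"
      using conj_generated_descent[OF nil fin cG K less.prems(2,3) False] by blast
    have SK: "S \<subseteq> K" using S by blast
    obtain ws' where ws': "coset_tour {a, b} K ws'" "generate G (insert (lprod ws') S) = K"
      using coset_tour_generating[OF fin ab c S(1) K SK norm d(1,3) p less.prems(4)] by blast
    obtain ws'' where "coset_tour {a, b} S ws''"
      using coset_tour_lift[OF fin _ S(1) K norm ws'] ab by blast
    moreover have "card S < card K"
      using S(3) fin K subgroup.subset by (metis finite_subset psubset_card_mono)
    ultimately show ?thesis using less.hyps[of S] S by blast
  qed
qed

text \<open>The start is the one-letter tour of the single coset \<open>carrier G\<close>. Modulo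
  the normal closure \<open>N\<close> of \<open>c\<close> the generators \<open>a\<close> and
  \<open>b\<close> coincide, so \<open>a\<close> generates \<open>G/N\<close> and the tour lifts to
  \<open>N\<close>, where the descent begins.\<close>

lemma coset_tour_exists:
  assumes nil: "nilpotent G" and fin: "finite (carrier G)"
    and ab: "a \<in> carrier G" "b \<in> carrier G" and gen: "generate G {a, b} = carrier G"
  shows "\<exists>ws. coset_tour {a, b} (generate G {a \<otimes> inv b}) ws"
proof -
  define c where "c = a \<otimes> inv b"
  have c: "c \<in> carrier G" using ab by (simp add: c_def)
  have cc: "c \<in> conjs c (carrier G)"
  proof -
    have "c = \<one> \<otimes> c \<otimes> inv \<one>" using c by simp
    then show ?thesis using c unfolding conjs_def by blast
  qed
  define N where "N = normal_closure_in (carrier G) {c}"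
  have cl: "{c} \<subseteq> carrier G" using c by simp
  note N = normal_closure_in[OF subgroup_self cl, folded N_def]
  have Nc: "generate G (conjs c N) = N"
    unfolding N_def using normal_closure_in_conjs[OF c subgroup_self, of "{c}"] cc by simp
  have triv: "coset_tour {a, b} (carrier G) [a]"
    unfolding coset_tour_def
  proof (intro conjI ballI)
    fix g assume "g \<in> carrier G"
    then have "g = g \<otimes> lprod (take 0 [a])" by simp
    then show "\<exists>i<length [a]. g \<in> carrier G #> lprod (take i [a])"
      using \<open>g \<in> carrier G\<close> unfolding r_coset_def by auto
  qed (use ab in \<open>auto simp: order_def\<close>)
  have "generate G (insert a N) = carrier G"
  proof
    have sub: "subgroup (generate G (insert a N)) G"
      using ab N(3) by (intro generate_is_subgroup) auto
    then show "generate G (insert a N) \<subseteq> carrier G" using subgroup.subset by blast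
    have a: "a \<in> generate G (insert a N)" by (simp add: generate.incl)
    have "c \<in> generate G (insert a N)" using N(2) by (simp add: generate.incl)
    then have "inv c \<otimes> a \<in> generate G (insert a N)"
      using a sub subgroup.m_closed subgroup.m_inv_closed by metis
    moreover have "inv c \<otimes> a = b" using ab by (simp add: c_def word_simps)
    ultimately show "carrier G \<subseteq> generate G (insert a N)"
      using generate_subgroup_incl[OF _ sub, of "{a, b}"] a gen by auto
  qed
  then obtain ws where "coset_tour {a, b} N ws"
    using coset_tour_lift[OF fin _ N(1) subgroup_self N(4) triv] ab by auto
  then show ?thesis
    using coset_tour_descent[OF nil fin ab c_def N(1) _ Nc] N(2) by (simp add: c_def)
qed


subsection \<open>The cyclic case and the hamiltonian path\<close>

text \<open>Take v repeatedly, and (c v) once every (ord v) steps.\<close>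

lemma cyclic_walk:
  assumes fin: "finite (carrier G)" and c: "c \<in> carrier G" and v: "v \<in> generate G {c}"
  obtains h :: "nat \<Rightarrow> 'a" where "h ` {..<card (generate G {c})} = generate G {c}"
    "\<And>l. h (Suc l) = h l \<otimes> v \<or> h (Suc l) = h l \<otimes> (c \<otimes> v)"
proof -
  let ?H = "generate G {c}"
  have H: "subgroup ?H G" using c by (intro generate_is_subgroup) simp
  have pow: "\<exists>i::nat. y = c [^] i" if "y \<in> ?H" for y
    using that generate_pow_on_finite_carrier[OF fin c] by auto
  have HG: "?H \<subseteq> carrier G" using H subgroup.subset by blast
  have comm: "y \<otimes> z = z \<otimes> y" if "y \<in> ?H" "z \<in> ?H" for y z
    using pow[OF that(1)] pow[OF that(2)] nat_pow_comm[OF c] by auto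
  have vG: "v \<in> carrier G" using v HG by blast
  have cH: "c \<in> ?H" by (simp add: generate.incl)
  define V where "V = generate G {v}"
  have V: "subgroup V G" using vG unfolding V_def by (intro generate_is_subgroup) simp
  have VH: "V \<subseteq> ?H" unfolding V_def using generate_subgroup_incl[OF _ H] v by simp
  have gen: "generate G (insert c V) = ?H"
    using generate_subgroup_incl[OF _ H, of "insert c V"] VH cH
      mono_generate[of "{c}" "insert c V"] by auto
  define m where "m = ord v"
  have m: "m > 0" "card V = m"
    using ord_ge_1[OF fin vG] generate_pow_card[OF vG] by (auto simp: m_def V_def)
  have vm: "v [^] m = \<one>" using vG by (simp add: m_def)
  have vmod: "v [^] n = v [^] (n mod m)" for n :: nat
  proof -
    have "v [^] n = (v [^] m) [^] (n div m) \<otimes> v [^] (n mod m)"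
      using vG by (simp add: nat_pow_pow nat_pow_mult)
    then show ?thesis using vG vm by simp
  qed
  obtain r where r: "r > 0" "\<And>j::nat. c [^] j \<in> V \<longleftrightarrow> r dvd j"
    using pow_mem_iff_dvd[OF fin V c] by blast
  have norm: "k \<otimes> y \<otimes> inv k \<in> V" if "k \<in> generate G (insert c V)" "y \<in> V" for k y
  proof -
    have "k \<otimes> y = y \<otimes> k" using comm that gen VH by blast
    moreover have "k \<in> carrier G" "y \<in> carrier G" using that gen HG VH by auto
    ultimately have "k \<otimes> y \<otimes> inv k = y" by (simp add: m_assoc)
    then show ?thesis using that by simp
  qed
  have card: "card ?H = r * m"
    using card_generate_insert[OF fin V c norm r] gen m(2) by simp
  \<comment> \<open>Each step contributes a factor \<open>v\<close>, and each completed block of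
    \<open>m\<close> steps one factor \<open>c\<close>; the two commute.\<close>
  define h where "h l = v [^] l \<otimes> c [^] (l div m)" for l :: nat
  have hH: "h l \<in> ?H" for l
    unfolding h_def using pow_mem_subgroup[OF H v] pow_mem_subgroup[OF H cH] subgroup.m_closed[OF H] by blast
  have "h ` {..<card ?H} = ?H"
  proof
    show "h ` {..<card ?H} \<subseteq> ?H" using hH by auto
    show "?H \<subseteq> h ` {..<card ?H}"
    proof
      fix y assume y: "y \<in> ?H"
      then have yG: "y \<in> carrier G" using HG by blast
      obtain j :: nat where j: "V #> y = V #> c [^] j"
        using generate_insert_rcos[OF fin V c norm, of y] y gen by auto
      also have "\<dots> = V #> c [^] (j mod r)"
        using r(2)[of r] by (intro rcos_pow_mod_cong[OF V c]) auto
      finally have "y \<in> V #> c [^] (j mod r)" using rcos_mem_iff[OF V yG] c by simp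
      then obtain w where w: "w \<in> V" "y = w \<otimes> c [^] (j mod r)" by (auto simp: r_coset_def)
      obtain i :: nat where "w = v [^] i"
        using w(1) generate_pow_on_finite_carrier[OF fin vG] by (auto simp: V_def)
      then have wi: "w = v [^] (i mod m)" using vmod by simp
      \<comment> \<open>The quotient of \<open>l\<close> by \<open>m\<close> sets the exponent of
        \<open>c\<close>, and its remainder the power of \<open>v\<close>, since
        \<open>v [^] m = \<one>\<close>.\<close>
      define l where "l = (j mod r) * m + i mod m"
      have "l div m = j mod r" "l mod m = i mod m" using m(1) by (auto simp: l_def)
      then have "y = h l" using w(2) wi vmod[of l] by (simp add: h_def)
      moreover have "l < card ?H"
      proof -
        have "l < Suc (j mod r) * m" using m(1) by (simp add: l_def)
        also have "\<dots> \<le> r * m" using r(1) by (intro mult_le_mono1) (simp add: Suc_le_eq)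
        finally show ?thesis using card by simp
      qed
      ultimately show "y \<in> h ` {..<card ?H}" by blast
    qed
  qed
  moreover have "h (Suc l) = h l \<otimes> v \<or> h (Suc l) = h l \<otimes> (c \<otimes> v)" for l
  proof -
    have cl: "c [^] (l div m) \<otimes> v = v \<otimes> c [^] (l div m)"
      using comm v pow_mem_subgroup[OF H cH] by blast
    have cv: "c \<otimes> v = v \<otimes> c" using comm v cH by blast
    show ?thesis
    proof (cases "Suc l mod m = 0")
      case True
      then have "Suc l div m = Suc (l div m)" by (simp add: div_Suc)
      then have "h (Suc l) = v [^] l \<otimes> (v \<otimes> c [^] (l div m)) \<otimes> c"
        using vG c by (simp add: h_def m_assoc)
      also have "\<dots> = h l \<otimes> (c \<otimes> v)"
        unfolding cl[symmetric] cv using vG c by (simp add: h_def m_assoc)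
      finally show ?thesis ..
    next
      case False
      then have "Suc l div m = l div m" by (simp add: div_Suc)
      then have "h (Suc l) = v [^] l \<otimes> (v \<otimes> c [^] (l div m))"
        using vG c by (simp add: h_def m_assoc)
      also have "\<dots> = h l \<otimes> v" unfolding cl[symmetric] using vG c by (simp add: h_def m_assoc)
      finally show ?thesis ..
    qed
  qed
  ultimately show ?thesis using that by blast
qed

section \<open>Expanding walks to hamiltonian paths\<close>

text \<open>No vertex repeats, by counting: a list of length \<open>order G\<close> covers all
  \<open>order G\<close> elements.\<close>

lemma hamiltonian_path_of_walk:
  assumes fin: "finite (carrier G)"
    and cover: "carrier G \<subseteq> f ` {..<order G}" and start: "f ` {..<order G} \<subseteq> carrier G"
    and step: "\<And>i. Suc i < order G \<Longrightarrow> \<exists>s\<in>S. f (Suc i) = f i \<otimes> s"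
  shows "hamiltonian_path (with_proj (cayley_digraph G S)) (map f [0..<order G])"
proof -
  have pos: "order G > 0" using fin order_gt_0_iff_finite by blast
  have img: "f ` {..<order G} = carrier G" using cover start by blast
  then have set: "set (map f [0..<order G]) = carrier G" by (simp add: atLeast0LessThan)
  then have "card (set (map f [0..<order G])) = length (map f [0..<order G])"
    by (simp add: order_def)
  then have dist: "distinct (map f [0..<order G])" by (rule card_distinct)
  have arcs: "set (vwalk_arcs (map f [0..<n])) \<subseteq> {(g, g \<otimes> s) | g s. g \<in> carrier G \<and> s \<in> S}"
    if "n \<le> order G" for n
    using that
  proof (induction n)
    case (Suc n)
    show ?case
    proof (cases n)
      case (Suc k)
      have "vwalk_arcs (map f [0..<Suc n]) = vwalk_arcs (map f [0..<n]) @ [(f k, f n)]"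
        using vwalk_arcs_append[of "map f [0..<n]" "[f n]"] Suc by (simp del: upt_Suc add: upt_Suc_append last_map)
      moreover have "f k \<in> carrier G" using start Suc.prems Suc by auto
      moreover obtain s where "s \<in> S" "f n = f k \<otimes> s" using step[of k] Suc.prems Suc by auto
      ultimately show ?thesis using Suc.IH Suc.prems by auto
    qed simp
  qed simp
  have ends: "arcs_ends (with_proj (cayley_digraph G S)) = {(g, g \<otimes> s) | g s. g \<in> carrier G \<and> s \<in> S}"
    by (auto simp: cayley_digraph_def arcs_ends_def arc_to_ends_def)
  have verts: "verts (with_proj (cayley_digraph G S)) = carrier G" by (simp add: cayley_digraph_def)
  show ?thesis
    unfolding hamiltonian_path_def vpath_def vwalk_def ends verts
    using set dist arcs[of "order G"] pos by auto
qed

text \<open>The path consists of blocks of \<open>n\<close> vertices. Block \<open>l\<close> starts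
  at \<open>h l \<otimes> inv W\<close>, follows \<open>w\<close> and ends at \<open>h l\<close> in
  \<open>H\<close>. From there \<open>b\<close> and \<open>a\<close> lead to the starts of the
  blocks for \<open>h l \<otimes> (b \<otimes> W)\<close> and
  \<open>h l \<otimes> (c \<otimes> (b \<otimes> W))\<close>, which are the two steps allowed to
  \<open>h\<close>.\<close>

lemma hamiltonian_path_of_coset_tour:
  assumes fin: "finite (carrier G)" and ab: "a \<in> carrier G" "b \<in> carrier G"
    and tour: "coset_tour {a, b} (generate G {a \<otimes> inv b}) ws"
  shows "\<exists>p. hamiltonian_path (with_proj (cayley_digraph G {a, b})) p"
proof -
  define c where "c = a \<otimes> inv b"
  have c: "c \<in> carrier G" using ab by (simp add: c_def)
  define H where "H = generate G {c}"
  have H: "subgroup H G" unfolding H_def using c by (intro generate_is_subgroup) simp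
  have HG: "H \<subseteq> carrier G" using H subgroup.subset by blast
  have ws: "set ws \<subseteq> {a, b}" "length ws * card H = order G" "lprod ws \<in> H"
    and cover: "\<And>g. g \<in> carrier G \<Longrightarrow> \<exists>i<length ws. g \<in> H #> lprod (take i ws)"
    using tour by (auto simp: coset_tour_def H_def c_def)
  have "order G > 0" using fin order_gt_0_iff_finite by blast
  then have "ws \<noteq> []" using ws(2) by auto
  then obtain s w where sw: "ws = s # w" by (cases ws) auto
  define n where "n = length ws"
  have n: "n > 0" "length w = n - 1" using sw by (auto simp: n_def)
  have s: "s = a \<or> s = b" and wab: "set w \<subseteq> {a, b}" using ws(1) sw by auto
  have sG: "s \<in> carrier G" using s ab by auto
  have wG: "set w \<subseteq> carrier G" using wab ab by auto
  have tG: "lprod (take j w) \<in> carrier G" for j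
    using wG set_take_subset lprod_closed by (metis subset_trans)
  define W where "W = lprod w"
  have WG: "W \<in> carrier G" using wG by (simp add: W_def)
  have sW: "s \<otimes> W \<in> H" using ws(3) by (simp add: sw W_def)
  have cH: "c \<in> H" by (simp add: H_def generate.incl)
  have a_cb: "a = c \<otimes> b" using ab by (simp add: c_def m_assoc)
  \<comment> \<open>The first letter \<open>s\<close> may be \<open>a\<close>; then
    \<open>a = c \<otimes> b\<close> with \<open>c \<in> H\<close> gives the same conclusion for
    \<open>b\<close>.\<close>
  have bW: "b \<otimes> W \<in> H"
  proof (cases "s = b")
    case False
    then have "b \<otimes> W = inv c \<otimes> (s \<otimes> W)" using s a_cb c ab WG by (simp add: word_simps)
    then show ?thesis using sW cH H subgroup.m_closed subgroup.m_inv_closed by metis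
  qed (use sW in simp)
  have "b \<otimes> W \<in> generate G {c}" using bW by (simp add: H_def)
  then obtain h where h: "h ` {..<card H} = H"
    "\<And>l. h (Suc l) = h l \<otimes> (b \<otimes> W) \<or> h (Suc l) = h l \<otimes> (c \<otimes> (b \<otimes> W))"
    using cyclic_walk[OF fin c] unfolding H_def by blast
  have hsurj: "\<exists>l<card H. h l = y" if "y \<in> H" for y using h(1) that by (metis imageE lessThan_iff)
  define f where "f i = h (i div n) \<otimes> inv W \<otimes> lprod (take (i mod n) w)" for i
  have hG: "h l \<in> carrier G" if "l < card H" for l using h(1) HG that by auto
  have oG: "order G = card H * n" using ws(2) by (simp add: n_def mult.commute)
  have div: "i div n < card H" if "i < order G" for i
    using that oG n(1) by (simp add: less_mult_imp_div_less)
  have idx: "l * n + j < order G" "(l * n + j) div n = l" "(l * n + j) mod n = j"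
    if "l < card H" "j < n" for l j
  proof -
    have "l * n + j < Suc l * n" using that by simp
    also have "\<dots> \<le> card H * n" using that by (intro mult_le_mono1) simp
    finally show "l * n + j < order G" using oG by simp
  qed (use that in auto)
  have "hamiltonian_path (with_proj (cayley_digraph G {a, b})) (map f [0..<order G])"
  proof (rule hamiltonian_path_of_walk[OF fin])
    show "f ` {..<order G} \<subseteq> carrier G"
      using div hG WG tG by (auto simp: f_def)
    show "carrier G \<subseteq> f ` {..<order G}"
    proof
      fix g assume "g \<in> carrier G"
      then obtain i where i: "i < n" "g \<in> H #> lprod (take i ws)" using cover n_def by blast
      then obtain y where y: "y \<in> H" "g = y \<otimes> lprod (take i ws)" by (auto simp: r_coset_def)
      have yG: "y \<in> carrier G" using y HG by blast
      show "g \<in> f ` {..<order G}"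
      proof (cases i)
        case 0
        \<comment> \<open>An element of \<open>H\<close> itself is the last vertex of its block,
          where all \<open>n - 1\<close> letters of \<open>w\<close> have been read.\<close>
        obtain l where l: "l < card H" "h l = y" using hsurj[OF y(1)] by blast
        have "n - 1 < n" using n by simp
        note ix = idx[OF l(1) this]
        have "f (l * n + (n - 1)) = y \<otimes> inv W \<otimes> W"
          unfolding f_def ix(2,3) using l n(2) by (simp add: W_def)
        also have "\<dots> = g" using y(2) 0 yG WG by (simp add: m_assoc)
        finally show ?thesis using ix(1) by blast
      next
        case (Suc j)
        \<comment> \<open>Outside \<open>H\<close> the letter \<open>s\<close> has already been
          read, and \<open>y \<otimes> s\<close> is the start \<open>h l \<otimes> inv W\<close> of
          a block.\<close>
        have "y \<otimes> (s \<otimes> W) \<in> H" using y sW H subgroup.m_closed by fast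
        then obtain l where l: "l < card H" "h l = y \<otimes> (s \<otimes> W)" using hsurj by blast
        have "j < n" using Suc i by simp
        note ix = idx[OF l(1) this]
        have "f (l * n + j) = y \<otimes> (s \<otimes> W) \<otimes> inv W \<otimes> lprod (take j w)"
          unfolding f_def ix(2,3) using l by simp
        also have "\<dots> = g" using y(2) Suc sw yG sG WG tG by (simp add: word_simps)
        finally show ?thesis using ix(1) by blast
      qed
    qed
  next
    fix i assume i: "Suc i < order G"
    have hi: "h (i div n) \<in> carrier G" using div[of i] hG i by simp
    show "\<exists>x\<in>{a, b}. f (Suc i) = f i \<otimes> x"
    proof (cases "Suc i mod n = 0")
      case True
      then have q: "Suc i div n = Suc (i div n)" "i mod n = n - 1"
        using n(1) by (auto simp: div_Suc mod_Suc split: if_splits)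
      have fi: "f i = h (i div n)" using q n(2) hi WG by (simp add: f_def W_def[symmetric] m_assoc)
      have "f (Suc i) = h (Suc (i div n)) \<otimes> inv W \<otimes> \<one>"
        unfolding f_def q(1) True by simp
      moreover have "h (i div n) \<otimes> (b \<otimes> W) \<otimes> inv W \<otimes> \<one> = h (i div n) \<otimes> b"
        using hi ab WG by (simp add: m_assoc)
      moreover have "h (i div n) \<otimes> (c \<otimes> (b \<otimes> W)) \<otimes> inv W \<otimes> \<one> = h (i div n) \<otimes> a"
        using hi ab c WG by (simp add: a_cb m_assoc)
      ultimately show ?thesis using h(2)[of "i div n"] fi by auto
    next
      case False
      define j where "j = i mod n"
      have q: "Suc i div n = i div n" "Suc i mod n = Suc j"
        using False by (auto simp: div_Suc mod_Suc j_def)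
      then have "j < length w" using n mod_less_divisor[OF n(1), of "Suc i"] by simp
      then have t: "take (Suc j) w = take j w @ [w ! j]" "w ! j \<in> {a, b}"
        using subsetD[OF wab nth_mem[of j w]] by (auto simp: take_Suc_conv_app_nth)
      have wjG: "w ! j \<in> carrier G" using t(2) ab by auto
      have "set (take j w) \<subseteq> carrier G" using wG set_take_subset by fast
      then have "f (Suc i) = f i \<otimes> w ! j"
        unfolding f_def q t(1) j_def[symmetric] using hi WG tG wjG by (simp add: lprod_append m_assoc)
      then show ?thesis using t(2) by blast
    qed
  qed
  then show ?thesis by blast
qed

end

theorem theorem1p2:
  fixes G :: "('a, 'm) monoid_scheme" and a b :: 'a
  assumes "group G"
    and "finite (carrier G)"
    and "nilpotent G"
    and "a \<in> carrier G" and "b \<in> carrier G"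
    and "generate G {a, b} = carrier G"
  shows "\<exists>p. hamiltonian_path (with_proj (cayley_digraph G {a, b})) p"
proof -
  interpret group G by fact
  obtain ws where "coset_tour {a, b} (generate G {a \<otimes>\<^bsub>G\<^esub> inv\<^bsub>G\<^esub> b}) ws"
    using coset_tour_exists assms by blast
  then show ?thesis using hamiltonian_path_of_coset_tour assms by blast
qed

end
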